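(* Suppose that $\delta>2\alpha_1+\beta_1$. There is a constant $C>0$ depending only on $\alpha_1,\beta_1,\delta$ such that the following holds. Let $f_0:\mathbb{N}\to[0,\infty)$ satisfy $m_\kappa\langle f_0\rangle<\infty$ for a fixed $\kappa>\max\{\delta,1,2-\alpha_1-\beta_1\}$, and let $f(t)$ be the solution of the discrete equation $\frac{\partial f}{\partial t}=O[f]$ with initial data $f_0$. Fix any $a\in[1,\infty)$ and assume that $\lambda>0$ satisfies $$\lambda<\min\Bigl\{\Bigl(4C(\sqrt a)^{\frac{\delta}{\delta-2\alpha_1-\beta_1}}\Bigr)^{-\frac{1}{\delta a}},\;\bigl(4\,m_1\langle f_0\rangle\,\mathcal{E}_a(1)\bigr)^{-\frac1a}\Bigr\}.$$ If the initial data satisfies $$\sum_{i=1}^\infty f_0(i)\,\mathcal{E}_a(\lambda^a\,ih)\le1,$$ then the solution satisfies, for all $t\in[0,\infty)$, $$\sum_{i=1}^\infty f_i(t)\,\mathcal{E}_a(\lambda^a\,ih)\le1.$$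
   Context: $\mathbb{N}=\{1,2,3,\dots\}$. For $a\in[1,\infty)$, $\mathcal{E}_a(x):=\sum_{k=1}^\infty\frac{x^k}{\Gamma(ak+1)}$. If $m_1\langle f_0\rangle=0$, the second quantity in the minimum is read as $+\infty$. Fix a mesh size $h>0$ and positive real parameters $\alpha_n,\beta_n$ ($n\in\{1,2,3\}$) and $\delta$ with $\delta>\max_{n\in\{1,2,3\}}(\alpha_n+\beta_n)$ and $\delta>2\alpha_1+\beta_1-1$. For $x,y\ge 0$ let $K_n(x,y)=x^{\alpha_n}y^{\alpha_n}(x+y)^{\beta_n}$ and $\gamma(x)=x^\delta$. For $f:\mathbb{N}\to\mathbb{R}$ and $i\in\mathbb{N}$ set $$S^{(1)}_i[f]=\sum_{j=1}^{i-1}K_1(jh,(i-j)h)f_jf_{i-j}-2\sum_{j=1}^\infty K_1(ih,jh)f_if_j,$$ and for $n\in\{2,3\}$ $$S^{(n)}_i[f]=-\sum_{j=1}^{i-1}K_n((i-j)h,jh)f_if_j+\sum_{j=i+1}^\infty K_n((j-i)h,ih)f_if_j+\sum_{j=i+1}^\infty K_n(ih,(j-i)h)f_jf_{j-i},$$ $V_i[f]=\gamma(ih)f_i$, $S[f]=S^{(1)}[f]+S^{(2)}[f]+S^{(3)}[f]$, and $O[f]=S[f]-V[f]$. The moments are $m_k\langle f\rangle=\sum_{i=1}^\infty f_i\,(ih)^k$, $k\ge 0$. For $k>\max\{1,2-\alpha_1-\beta_1\}$ and $x\ge0$ define $$\mathcal{B}_k(x)=\Bigl(2\,\mathcal{C}_k\,x^{1+\frac{\delta+k-1}{\delta-2\alpha_1-\beta_1+1}+\frac{\delta}{k-1}}\Bigr)^{\frac{k-1}{\delta+k-1}},$$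 where $\mathcal{C}_k$ is the positive constant $$\mathcal{C}_k=\frac{\delta-2\alpha_1-\beta_1+1}{\delta+k-1}\bigl[2^{\beta_1+1}(2^k-2)\bigr]^{\frac{\delta+k-1}{\delta-2\alpha_1-\beta_1+1}}\Bigl(\frac{2(2\alpha_1+\beta_1+k-2)}{\delta+k-1}\Bigr)^{\frac{2\alpha_1+\beta_1+k-2}{\delta-2\alpha_1-\beta_1+1}}.$$ "The solution" with initial datum $f_0$ means the global classical solution $f\in C^1([0,\infty);\ell^1(\mathbb{N}))$ of $\frac{\partial f}{\partial t}=O[f]$, $f(0)=f_0$, which for all $t\ge0$ satisfies $f(t,i)\ge0$, $m_1\langle f(t)\rangle\le m_1\langle f_0\rangle$ and $m_\kappa\langle f(t)\rangle\le\max\{m_\kappa\langle f_0\rangle,2\mathcal{B}_\kappa(m_1\langle f_0\rangle)\}$ (the paper's well-posedness theorem gives existence and uniqueness). *)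

theory Defs
  imports "HOL-Analysis.Analysis"
begin

text \<open>
  Sequences indexed by the positive integers are functions on \<^typ>\<open>nat\<close> whose value at 0
  is never used; all sums over positive integers range over \<open>{1..}\<close>.
  Unconditional summability on the reals is absolute summability, and \<^const>\<open>infsum\<close> is 0 on
  families that are not summable, so finiteness of a sum is always stated separately where it matters.
\<close>

definition kernel :: "real \<Rightarrow> real \<Rightarrow> real \<Rightarrow> real \<Rightarrow> real" where
  "kernel \<alpha> \<beta> x y = x powr \<alpha> * y powr \<alpha> * (x + y) powr \<beta>"

text \<open>The operator with superscript 1, for \<open>\<alpha> = \<alpha>\<^sub>1\<close> and \<open>\<beta> = \<beta>\<^sub>1\<close>.\<close>

definition S_forward :: "real \<Rightarrow> real \<Rightarrow> real \<Rightarrow> (nat \<Rightarrow> real) \<Rightarrow> nat \<Rightarrow> real" where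
  "S_forward h \<alpha> \<beta> f i =
     (\<Sum>j\<in>{1..<i}. kernel \<alpha> \<beta> (real j * h) (real (i - j) * h) * f j * f (i - j))
     - 2 * (\<Sum>\<^sub>\<infinity>j\<in>{1..}. kernel \<alpha> \<beta> (real i * h) (real j * h) * f i * f j)"

text \<open>The operators with superscripts 2 and 3, which differ only in the exponents of the kernel.\<close>

definition S_backward :: "real \<Rightarrow> real \<Rightarrow> real \<Rightarrow> (nat \<Rightarrow> real) \<Rightarrow> nat \<Rightarrow> real" where
  "S_backward h \<alpha> \<beta> f i =
     - (\<Sum>j\<in>{1..<i}. kernel \<alpha> \<beta> (real (i - j) * h) (real j * h) * f i * f j)
     + (\<Sum>\<^sub>\<infinity>j\<in>{i+1..}. kernel \<alpha> \<beta> (real (j - i) * h) (real i * h) * f i * f j)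
     + (\<Sum>\<^sub>\<infinity>j\<in>{i+1..}. kernel \<alpha> \<beta> (real i * h) (real (j - i) * h) * f j * f (j - i))"

definition V_op :: "real \<Rightarrow> real \<Rightarrow> (nat \<Rightarrow> real) \<Rightarrow> nat \<Rightarrow> real" where
  "V_op h \<delta> f i = (real i * h) powr \<delta> * f i"

definition O_op ::
  "real \<Rightarrow> real \<Rightarrow> real \<Rightarrow> real \<Rightarrow> real \<Rightarrow> real \<Rightarrow> real \<Rightarrow> real \<Rightarrow> (nat \<Rightarrow> real) \<Rightarrow> nat \<Rightarrow> real" where
  "O_op h \<alpha>1 \<beta>1 \<alpha>2 \<beta>2 \<alpha>3 \<beta>3 \<delta> f i =
     S_forward h \<alpha>1 \<beta>1 f i + S_backward h \<alpha>2 \<beta>2 f i + S_backward h \<alpha>3 \<beta>3 f i - V_op h \<delta> f i"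

definition finite_moment :: "real \<Rightarrow> real \<Rightarrow> (nat \<Rightarrow> real) \<Rightarrow> bool" where
  "finite_moment h k f \<longleftrightarrow> (\<lambda>i. f i * (real i * h) powr k) summable_on {1..}"

definition moment :: "real \<Rightarrow> real \<Rightarrow> (nat \<Rightarrow> real) \<Rightarrow> real" where
  "moment h k f = (\<Sum>\<^sub>\<infinity>i\<in>{1..}. f i * (real i * h) powr k)"

definition C_const :: "real \<Rightarrow> real \<Rightarrow> real \<Rightarrow> real \<Rightarrow> real" where
  "C_const \<alpha>1 \<beta>1 \<delta> k =
     (\<delta> - 2 * \<alpha>1 - \<beta>1 + 1) / (\<delta> + k - 1)
     * (2 powr (\<beta>1 + 1) * (2 powr k - 2)) powr ((\<delta> + k - 1) / (\<delta> - 2 * \<alpha>1 - \<beta>1 + 1))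
     * (2 * (2 * \<alpha>1 + \<beta>1 + k - 2) / (\<delta> + k - 1))
         powr ((2 * \<alpha>1 + \<beta>1 + k - 2) / (\<delta> - 2 * \<alpha>1 - \<beta>1 + 1))"

definition B_bound :: "real \<Rightarrow> real \<Rightarrow> real \<Rightarrow> real \<Rightarrow> real \<Rightarrow> real" where
  "B_bound \<alpha>1 \<beta>1 \<delta> k x =
     (2 * C_const \<alpha>1 \<beta>1 \<delta> k
      * x powr (1 + (\<delta> + k - 1) / (\<delta> - 2 * \<alpha>1 - \<beta>1 + 1) + \<delta> / (k - 1)))
     powr ((k - 1) / (\<delta> + k - 1))"

definition E_fun :: "real \<Rightarrow> real \<Rightarrow> real" where
  "E_fun a x = (\<Sum>\<^sub>\<infinity>k\<in>{1::nat..}. x ^ k / Gamma (a * real k + 1))"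

definition ell1 :: "(nat \<Rightarrow> real) set" where
  "ell1 = {u. (\<lambda>i. \<bar>u i\<bar>) summable_on {1..}}"

definition ell1_norm :: "(nat \<Rightarrow> real) \<Rightarrow> real" where
  "ell1_norm u = (\<Sum>\<^sub>\<infinity>i\<in>{1..}. \<bar>u i\<bar>)"

text \<open>
  \<open>f\<close> is a continuously differentiable curve from \<open>[0,\<infinity>)\<close> to the Banach space \<^const>\<open>ell1\<close>
  with derivative \<open>g\<close>, where limits are taken in norm and the derivative at 0 is one-sided.
\<close>

definition ell1_C1 :: "(real \<Rightarrow> nat \<Rightarrow> real) \<Rightarrow> (real \<Rightarrow> nat \<Rightarrow> real) \<Rightarrow> bool" where
  "ell1_C1 f g \<longleftrightarrow>
     (\<forall>t\<ge>0. f t \<in> ell1 \<and> g t \<in> ell1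
       \<and> ((\<lambda>s. ell1_norm (\<lambda>i. (f s i - f t i) / (s - t) - g t i)) \<longlongrightarrow> 0) (at t within {0..})
       \<and> ((\<lambda>s. ell1_norm (\<lambda>i. g s i - g t i)) \<longlongrightarrow> 0) (at t within {0..}))"

text \<open>
  The series in \<^const>\<open>O_op\<close> converge for \<open>f t\<close>, since a nonnegative sequence
  with a finite moment of order \<open>\<kappa> > \<delta> > \<alpha>\<^sub>n + \<beta>\<^sub>n\<close> is bounded and has finite moments
  of all orders in \<open>[0,\<kappa>]\<close>.
\<close>

definition is_solution ::
  "real \<Rightarrow> real \<Rightarrow> real \<Rightarrow> real \<Rightarrow> real \<Rightarrow> real \<Rightarrow> real \<Rightarrow> real \<Rightarrow> real
    \<Rightarrow> (nat \<Rightarrow> real) \<Rightarrow> (real \<Rightarrow> nat \<Rightarrow> real) \<Rightarrow> bool" where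
  "is_solution h \<alpha>1 \<beta>1 \<alpha>2 \<beta>2 \<alpha>3 \<beta>3 \<delta> \<kappa> f0 f \<longleftrightarrow>
     ell1_C1 f (\<lambda>t. O_op h \<alpha>1 \<beta>1 \<alpha>2 \<beta>2 \<alpha>3 \<beta>3 \<delta> (f t))
     \<and> (\<forall>i\<ge>1. f 0 i = f0 i)
     \<and> (\<forall>t\<ge>0. (\<forall>i\<ge>1. f t i \<ge> 0)
          \<and> finite_moment h 1 (f t) \<and> moment h 1 (f t) \<le> moment h 1 f0
          \<and> finite_moment h \<kappa> (f t)
          \<and> moment h \<kappa> (f t) \<le> max (moment h \<kappa> f0) (2 * B_bound \<alpha>1 \<beta>1 \<delta> \<kappa> (moment h 1 f0)))"

end

theory Submission
  imports Defs
begin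

text \<open>
  Test the equation with \<open>w(x) = E\<^sub>a(\<lambda>\<^sup>a x)\<close>. For \<open>a \<ge> 1\<close> the ratio
  \<open>\<Gamma>(ak+1) / (\<Gamma>(al+1) \<Gamma>(a(k-l)+1))\<close> increases with \<open>a\<close>, because the digamma function is increasing,
  and it is a binomial coefficient at \<open>a = 1\<close>; by the Cauchy product of the series this gives
  \<open>w(x+y) - w(x) - w(y) \<le> w(x) w(y)\<close>. Moreover \<open>w\<close> is superadditive, so the two backward operators
  contribute nonpositive terms. Put \<open>D = \<Sum> (ih)\<^sup>\<delta> w f\<close> and suppose that \<open>\<Sum> w f = 1\<close>. Interpolation bounds
  the forward contribution by a constant times \<open>D\<^sup>\<theta>\<close> with \<open>\<theta> = (2\<alpha>\<^sub>1+\<beta>\<^sub>1)/\<delta> < 1\<close>, and the smallness of \<open>\<lambda>\<close>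
  makes \<open>D\<close> so large that the absorption term \<open>-D\<close> wins. Hence \<open>\<Sum> w f\<close> has a negative derivative whenever
  it equals 1, and it cannot exceed 1.

  Since \<open>\<Sum> w f\<close> is not known to be finite at positive times, the argument is applied to the bounded weight
  \<open>w(min x R)\<close>. This breaks superadditivity only for total mass beyond \<open>R\<close>; there the error is at most a
  multiple \<open>R powr (\<alpha>\<^sub>n + \<beta>\<^sub>n - \<delta>)\<close> of \<open>D\<close>, uniformly in time by the bound on the moment of order \<open>\<kappa>\<close>.
\<close>

section \<open>The Mittag-Leffler weight\<close>

lemma binomial_mult_Gamma_le:
  fixes a :: real
  assumes a: "a \<ge> 1" and l: "l \<le> k"
  shows "real (k choose l) * (Gamma (a * real l + 1) * Gamma (a * real (k - l) + 1))
    \<le> Gamma (a * real k + 1)"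
proof -
  define m where "m = k - l"
  have k: "k = l + m" using l by (simp add: m_def)
  \<comment> \<open>\<open>H b\<close> is the logarithm of the Gamma quotient at parameter b. It
    suffices that \<open>H\<close> does not decrease from 1 to a, since \<open>exp (H 1)\<close> is
    the binomial coefficient.\<close>
  define H where "H b = ln_Gamma (b * real k + 1) - ln_Gamma (b * real l + 1) - ln_Gamma (b * real m + 1)" for b :: real
  have "H 1 \<le> H a"
  proof (rule DERIV_nonneg_imp_nondecreasing[OF a])
    fix b :: real assume b: "1 \<le> b" "b \<le> a"
    have pos: "b * real n + 1 > 0" for n using b by (simp add: add_nonneg_pos)
    let ?D = "real k * Digamma (b * real k + 1) - real l * Digamma (b * real l + 1) - real m * Digamma (b * real m + 1)"
    have "(H has_real_derivative ?D) (at b)"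
      unfolding H_def using pos by (auto intro!: derivative_eq_intros)
    \<comment> \<open>As l + m = k, the derivative is l and m times the differences of the Digamma
      value at b k + 1 and those at b l + 1 and b m + 1; both differences are nonnegative.\<close>
    moreover have "Digamma (b * real l + 1) \<le> Digamma (b * real k + 1)"
      "Digamma (b * real m + 1) \<le> Digamma (b * real k + 1)"
      using b pos by (auto intro!: Digamma_real_mono mult_left_mono simp: k)
    then have "real l * Digamma (b * real l + 1) + real m * Digamma (b * real m + 1) \<le>
       real l * Digamma (b * real k + 1) + real m * Digamma (b * real k + 1)"
      by (intro add_mono mult_left_mono) auto
    then have "?D \<ge> 0" by (simp add: k algebra_simps)
    ultimately show "\<exists>y. DERIV H b :> y \<and> 0 \<le> y" by blast
  qed
  then have "exp (H 1) \<le> exp (H a)" by simp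
  moreover have "exp (H b) = Gamma (b * real k + 1) / (Gamma (b * real l + 1) * Gamma (b * real m + 1))"
    if "b \<ge> 1" for b
  proof -
    have pos: "b * real n + 1 > 0" for n using that by (simp add: add_nonneg_pos)
    show ?thesis unfolding H_def using pos by (simp add: exp_diff Gamma_real_pos_exp)
  qed
  moreover have "Gamma (1 * real k + 1) / (Gamma (1 * real l + 1) * Gamma (1 * real m + 1)) = real (k choose l)"
    using l Gamma_fact[of k, where 'a=real] Gamma_fact[of l, where 'a=real] Gamma_fact[of m, where 'a=real]
    by (simp add: binomial_fact m_def add.commute)
  ultimately have "real (k choose l) \<le> Gamma (a * real k + 1) / (Gamma (a * real l + 1) * Gamma (a * real m + 1))"
    using a by simp
  moreover have "a * real n + 1 > 0" for n using a by (simp add: add_nonneg_pos)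
  ultimately show ?thesis
    by (simp add: field_simps m_def)
qed

text \<open>The induction drops the cross terms of a product. The bound fails for k = 0, so
  superadditivity belongs to \<open>E_fun\<close>, whose series starts at k = 1, and not to the
  complete Mittag-Leffler series.\<close>

lemma power_add_le_add_power:
  fixes x y :: real
  assumes "0 \<le> x" "0 \<le> y" "k \<ge> 1"
  shows "x ^ k + y ^ k \<le> (x + y) ^ k"
  using assms(3)
proof (induction k rule: dec_induct)
  case (step n)
  have "x ^ Suc n + y ^ Suc n \<le> (x + y) * (x ^ n + y ^ n)"
    using assms by (simp add: algebra_simps)
  also have "\<dots> \<le> (x + y) * (x + y) ^ n"
    using step assms by (intro mult_left_mono) auto
  finally show ?case by simp
qed simp

context
  fixes a :: real
  assumes a: "a \<ge> 1"
begin

lemma Gamma_mult_add_one_pos: "Gamma (a * real k + 1) > 0"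
  using a by (intro Gamma_real_pos) (simp add: add_nonneg_pos)

lemma Mittag_Leffler_term_nonneg: "(x::real) \<ge> 0 \<Longrightarrow> x ^ k / Gamma (a * real k + 1) \<ge> 0"
  using Gamma_mult_add_one_pos[of k] by simp

text \<open>The binomial inequality with l = 1 contributes a factor k + 1 and a factor
  \<open>Gamma (a + 1)\<close> in each step. The Mittag-Leffler series is thereby dominated by the
  exponential series at \<open>x / Gamma (a + 1)\<close>, which gives convergence.\<close>

lemma fact_mult_power_le_Gamma: "fact k * Gamma (a + 1) ^ k \<le> Gamma (a * real k + 1)"
proof (induction k)
  case (Suc k)
  have G: "Gamma (a + 1) > 0" using Gamma_mult_add_one_pos[of 1] by simp
  have "fact (Suc k) * Gamma (a + 1) ^ Suc k = real (Suc k) * (Gamma (a + 1) * (fact k * Gamma (a + 1) ^ k))"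
    by (simp add: algebra_simps)
  also have "\<dots> \<le> real (Suc k) * (Gamma (a + 1) * Gamma (a * real k + 1))"
    using G by (intro mult_left_mono Suc.IH) auto
  also have "\<dots> \<le> Gamma (a * real (Suc k) + 1)"
    using binomial_mult_Gamma_le[OF a, of 1 "Suc k"] by simp
  finally show ?case .
qed simp

lemma summable_Mittag_Leffler:
  fixes x :: real
  assumes "x \<ge> 0"
  shows "summable (\<lambda>k. x ^ k / Gamma (a * real k + 1))"
proof (rule summable_comparison_test')
  show "summable (\<lambda>k. (x / Gamma (a + 1)) ^ k / fact k)"
    using summable_exp[of "x / Gamma (a + 1)"] by (simp add: divide_inverse mult.commute)
  have G: "Gamma (a + 1) > 0" using Gamma_mult_add_one_pos[of 1] by simp
  fix k :: nat
  have "x ^ k / Gamma (a * real k + 1) \<le> x ^ k / (fact k * Gamma (a + 1) ^ k)"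
    using G assms Gamma_mult_add_one_pos[of k] by (intro divide_left_mono fact_mult_power_le_Gamma) auto
  then show "norm (x ^ k / Gamma (a * real k + 1)) \<le> (x / Gamma (a + 1)) ^ k / fact k"
    using assms Gamma_mult_add_one_pos[of k] by (simp add: power_divide mult.commute)
qed

lemma E_fun_has_sum:
  fixes x :: real
  assumes "x \<ge> 0"
  shows "((\<lambda>k. x ^ k / Gamma (a * real k + 1)) has_sum E_fun a x) {1..}"
proof -
  have "(\<lambda>k. x ^ k / Gamma (a * real k + 1)) summable_on UNIV"
    using summable_Mittag_Leffler[OF assms] Mittag_Leffler_term_nonneg[OF assms]
    by (subst summable_on_UNIV_nonneg_real_iff) auto
  then show ?thesis
    unfolding E_fun_def by (intro has_sum_infsum) (rule summable_on_subset, auto)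
qed

text \<open>Restores the term k = 0, whose value is 1, because the Cauchy product below multiplies
  complete series.\<close>

lemma E_fun_sums:
  fixes x :: real
  assumes "x \<ge> 0"
  shows "(\<lambda>k. x ^ k / Gamma (a * real k + 1)) sums (1 + E_fun a x)"
proof -
  have "((\<lambda>k. x ^ k / Gamma (a * real k + 1)) has_sum (1 + E_fun a x)) (insert 0 {1..})"
    using has_sum_insert[OF _ E_fun_has_sum[OF assms], of 0] by simp
  moreover have "insert 0 {1..} = (UNIV :: nat set)" by auto
  ultimately show ?thesis by (metis has_sum_imp_sums)
qed

lemma E_fun_mono:
  assumes "0 \<le> x" "x \<le> y"
  shows "E_fun a x \<le> E_fun a y"
  using assms Gamma_mult_add_one_pos
  by (intro has_sum_mono[OF E_fun_has_sum E_fun_has_sum] divide_right_mono power_mono)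
    (auto intro: less_imp_le)

lemma E_fun_nonneg: "0 \<le> x \<Longrightarrow> E_fun a x \<ge> 0"
  using has_sum_nonneg[OF E_fun_has_sum] Mittag_Leffler_term_nonneg by blast

text \<open>On [0,1] every power of order k \<ge> 1 is at most x. This linear bound lets the first
  moment control the weighted mass at small sizes.\<close>

lemma E_fun_le_mult:
  assumes "0 \<le> x" "x \<le> 1"
  shows "E_fun a x \<le> x * E_fun a 1"
proof (rule has_sum_mono[OF E_fun_has_sum has_sum_cmult_right[OF E_fun_has_sum]])
  fix k :: nat assume "k \<in> {1..}"
  then have "x ^ k \<le> x ^ 1" using assms by (intro power_decreasing) auto
  then show "x ^ k / Gamma (a * real k + 1) \<le> x * (1 ^ k / Gamma (a * real k + 1))"
    using Gamma_mult_add_one_pos[of k] by (simp add: divide_right_mono)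
qed (use assms in auto)

lemma E_fun_pos: assumes "0 < x" shows "E_fun a x > 0"
proof -
  have "x ^ 1 / Gamma (a * real 1 + 1) \<le> E_fun a x"
    using has_sum_mono'[OF has_sum_finite[of "{1}" "\<lambda>k. x ^ k / Gamma (a * real k + 1)"] E_fun_has_sum[of x]]
      assms Mittag_Leffler_term_nonneg[of x]
    by auto
  then show ?thesis using assms Gamma_mult_add_one_pos[of 1]
    by (smt (verit) divide_pos_pos power_one_right)
qed

lemma E_fun_superadditive:
  assumes "0 \<le> x" "0 \<le> y"
  shows "E_fun a x + E_fun a y \<le> E_fun a (x + y)"
proof (rule has_sum_mono[OF has_sum_add[OF E_fun_has_sum E_fun_has_sum] E_fun_has_sum])
  fix k :: nat assume "k \<in> {1..}"
  then show "x ^ k / Gamma (a * real k + 1) + y ^ k / Gamma (a * real k + 1)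
      \<le> (x + y) ^ k / Gamma (a * real k + 1)"
    using power_add_le_add_power[OF assms, of k] Gamma_mult_add_one_pos[of k]
    by (simp add: add_divide_distrib[symmetric] divide_right_mono)
qed (use assms in auto)

text \<open>After adding 1 to both sides the claim is that the complete series 1 +
  \<open>E_fun a\<close> is submultiplicative, and this is compared with the Cauchy product order by
  order.\<close>

lemma E_fun_add_le:
  assumes "0 \<le> x" "0 \<le> y"
  shows "E_fun a (x + y) \<le> E_fun a x + E_fun a y + E_fun a x * E_fun a y"
proof -
  let ?t = "\<lambda>x k. x ^ k / Gamma (a * real k + 1)"
  have nn: "?t x k \<ge> 0" "?t y k \<ge> 0" for k
    using assms Gamma_mult_add_one_pos[of k] by auto
  have "(\<lambda>k. \<Sum>i\<le>k. ?t x i * ?t y (k - i)) sums ((\<Sum>k. ?t x k) * (\<Sum>k. ?t y k))"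
    using summable_Mittag_Leffler[OF assms(1)] summable_Mittag_Leffler[OF assms(2)] nn
    by (intro Cauchy_product_sums) (simp_all only: real_norm_def abs_of_nonneg)
  then have S: "(\<lambda>k. \<Sum>i\<le>k. ?t x i * ?t y (k - i)) sums ((1 + E_fun a x) * (1 + E_fun a y))"
    using E_fun_sums[OF assms(1)] E_fun_sums[OF assms(2)] by (simp add: sums_iff)
  have "1 + E_fun a (x + y) \<le> (1 + E_fun a x) * (1 + E_fun a y)"
  proof (rule sums_le[OF _ E_fun_sums S])
    fix k
    have "(x + y) ^ k / Gamma (a * real k + 1)
        = (\<Sum>i\<le>k. (real (k choose i) / Gamma (a * real k + 1)) * (x ^ i * y ^ (k - i)))"
      by (simp add: binomial_ring sum_divide_distrib mult.assoc)
    also have "\<dots> \<le> (\<Sum>i\<le>k. ?t x i * ?t y (k - i))"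
    proof (rule sum_mono)
      \<comment> \<open>Each summand of the binomial expansion is at most the matching summand of
        the Cauchy product; this is the Gamma inequality in quotient form.\<close>
      fix i assume "i \<in> {..k}"
      then have "real (k choose i) / Gamma (a * real k + 1) \<le> 1 / (Gamma (a * real i + 1) * Gamma (a * real (k - i) + 1))"
        using binomial_mult_Gamma_le[OF a, of i k]
        by (simp add: pos_divide_le_eq pos_le_divide_eq Gamma_mult_add_one_pos del: of_nat_diff)
      then have "(real (k choose i) / Gamma (a * real k + 1)) * (x ^ i * y ^ (k - i))
         \<le> (1 / (Gamma (a * real i + 1) * Gamma (a * real (k - i) + 1))) * (x ^ i * y ^ (k - i))"
        using assms by (intro mult_right_mono) auto
      then show "(real (k choose i) / Gamma (a * real k + 1)) * (x ^ i * y ^ (k - i)) \<le> ?t x i * ?t y (k - i)"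
        by simp
    qed
    finally show "(x + y) ^ k / Gamma (a * real k + 1) \<le> (\<Sum>i\<le>k. ?t x i * ?t y (k - i))" .
  qed (use assms in auto)
  then show ?thesis by (simp add: algebra_simps)
qed

end

section \<open>Weak formulation of the collision operators\<close>

lemma has_sum_product_nonneg:
  fixes u v :: "_ \<Rightarrow> real"
  assumes "(u has_sum U) A" "(v has_sum V) B"
    and "\<And>x. x \<in> A \<Longrightarrow> u x \<ge> 0" "\<And>y. y \<in> B \<Longrightarrow> v y \<ge> 0"
  shows "((\<lambda>(x, y). u x * v y) has_sum (U * V)) (A \<times> B)"
proof (rule has_sum_SigmaI)
  show inner: "((\<lambda>y. case (x, y) of (x, y) \<Rightarrow> u x * v y) has_sum (u x * V)) B" for x
    using has_sum_cmult_right[OF assms(2)] by simp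
  show outer: "((\<lambda>x. u x * V) has_sum (U * V)) A"
    using has_sum_cmult_left[OF assms(1)] by simp
  show "(\<lambda>(x, y). u x * v y) summable_on A \<times> B"
    by (rule summable_on_SigmaI[OF inner has_sum_imp_summable[OF outer]]) (use assms(3,4) in auto)
qed

lemma summable_on_mult_bounded:
  fixes G \<psi> :: "_ \<Rightarrow> real"
  assumes "G summable_on A" "\<And>z. z \<in> A \<Longrightarrow> G z \<ge> 0"
    and "\<And>z. z \<in> A \<Longrightarrow> 0 \<le> \<psi> z \<and> \<psi> z \<le> c"
  shows "(\<lambda>z. \<psi> z * G z) summable_on A"
proof (rule summable_on_comparison_test)
  show "(\<lambda>z. c * G z) summable_on A" using assms(1) by (rule summable_on_cmult_right)
qed (use assms in \<open>auto intro: mult_right_mono\<close>)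

lemma has_sum_diff_real:
  fixes u v :: "_ \<Rightarrow> real"
  assumes "(u has_sum U) A" "(v has_sum V) A"
  shows "((\<lambda>x. u x - v x) has_sum (U - V)) A"
  using has_sum_add[OF assms(1) has_sum_uminusI[OF assms(2)]] by simp

text \<open>The power \<open>x powr (p - k)\<close> has a nonpositive exponent and is therefore
  largest at x = h. The role of h is played by the mesh size, by the interpolation threshold and by
  the cutoff.\<close>

lemma powr_le_mult_powr:
  fixes x h p k :: real
  assumes "0 < h" "h \<le> x" "p \<le> k"
  shows "x powr p \<le> h powr (p - k) * x powr k"
proof -
  have "x powr p = x powr (p - k) * x powr k" by (simp add: powr_add[symmetric])
  also have "\<dots> \<le> h powr (p - k) * x powr k"
    using assms by (intro mult_right_mono powr_mono2') auto
  finally show ?thesis .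
qed

lemma kernel_commute: "kernel \<alpha> \<beta> x y = kernel \<alpha> \<beta> y x"
  by (simp add: kernel_def algebra_simps)

lemma kernel_nonneg: "kernel \<alpha> \<beta> x y \<ge> 0"
  by (simp add: kernel_def)

text \<open>Follows from x + y \<le> 2 max x y. Each product on the right separates x from y, so
  double sums against it factor into moments.\<close>

lemma kernel_le_sum:
  assumes "0 < x" "0 < y" "\<beta> \<ge> 0"
  shows "kernel \<alpha> \<beta> x y \<le> 2 powr \<beta> * (x powr (\<alpha> + \<beta>) * y powr \<alpha> + x powr \<alpha> * y powr (\<alpha> + \<beta>))"
proof -
  have "(x + y) powr \<beta> \<le> (2 * max x y) powr \<beta>"
    using assms by (intro powr_mono2) auto
  also have "\<dots> = 2 powr \<beta> * max x y powr \<beta>" using assms by (simp add: powr_mult)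
  also have "\<dots> \<le> 2 powr \<beta> * (x powr \<beta> + y powr \<beta>)"
    by (intro mult_left_mono) (auto simp: max_def)
  finally have "kernel \<alpha> \<beta> x y \<le> x powr \<alpha> * y powr \<alpha> * (2 powr \<beta> * (x powr \<beta> + y powr \<beta>))"
    unfolding kernel_def by (intro mult_left_mono) auto
  then show ?thesis by (simp add: powr_add algebra_simps)
qed

text \<open>In the backward operators the two kernel arguments add up to y, so the last factor is
  exactly \<open>y powr \<beta>\<close>; enlarging y - x to y separates the variables.\<close>

lemma kernel_diff_le:
  assumes "0 < x" "x < y" "\<alpha> \<ge> 0"
  shows "kernel \<alpha> \<beta> (y - x) x \<le> x powr \<alpha> * y powr (\<alpha> + \<beta>)"
proof -
  have "(y - x) powr \<alpha> \<le> y powr \<alpha>" using assms by (intro powr_mono2) auto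
  then have "(y - x) powr \<alpha> * (x powr \<alpha> * y powr \<beta>) \<le> y powr \<alpha> * (x powr \<alpha> * y powr \<beta>)"
    by (intro mult_right_mono) auto
  then show ?thesis by (simp add: kernel_def powr_add algebra_simps)
qed

section \<open>Moments and weak forms at a fixed time\<close>

locale moment_bounded =
  fixes h \<kappa> :: real and f :: "nat \<Rightarrow> real"
  assumes h: "h > 0" and f_nonneg: "\<And>i. i \<ge> 1 \<Longrightarrow> f i \<ge> 0" and fin: "finite_moment h \<kappa> f"
begin

lemma mesh_le: "i \<ge> 1 \<Longrightarrow> h \<le> real i * h"
  using h by simp

lemma mesh_pos: "i \<ge> 1 \<Longrightarrow> 0 < real i * h"
  using h by simp

text \<open>The mesh points never fall below h, so the moment of order \<kappa> controls all lower
  orders, negative ones included.\<close>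

lemma summable_moment:
  assumes "p \<le> \<kappa>"
  shows "(\<lambda>i. (real i * h) powr p * f i) summable_on {1..}"
proof (rule summable_on_comparison_test)
  show "(\<lambda>i. h powr (p - \<kappa>) * (f i * (real i * h) powr \<kappa>)) summable_on {1..}"
    using fin unfolding finite_moment_def by (rule summable_on_cmult_right)
  fix i :: nat assume i: "i \<in> {1..}"
  have "(real i * h) powr p * f i \<le> h powr (p - \<kappa>) * (real i * h) powr \<kappa> * f i"
    using i h f_nonneg[of i] mesh_le[of i] assms by (intro mult_right_mono powr_le_mult_powr) auto
  then show "(real i * h) powr p * f i \<le> h powr (p - \<kappa>) * (f i * (real i * h) powr \<kappa>)"
    by (simp add: algebra_simps)
qed (use f_nonneg in auto)

lemma infsum_moment_le:
  assumes "p \<le> \<kappa>"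
  shows "(\<Sum>\<^sub>\<infinity>i\<in>{1..}. (real i * h) powr p * f i) \<le> h powr (p - \<kappa>) * moment h \<kappa> f"
proof (rule has_sum_mono)
  show "((\<lambda>i. (real i * h) powr p * f i) has_sum (\<Sum>\<^sub>\<infinity>i\<in>{1..}. (real i * h) powr p * f i)) {1..}"
    using summable_moment[OF assms] by (rule has_sum_infsum)
  show "((\<lambda>i. h powr (p - \<kappa>) * (f i * (real i * h) powr \<kappa>)) has_sum h powr (p - \<kappa>) * moment h \<kappa> f) {1..}"
    unfolding moment_def using fin unfolding finite_moment_def
    by (intro has_sum_cmult_right has_sum_infsum)
  fix i :: nat assume i: "i \<in> {1..}"
  have "(real i * h) powr p * f i \<le> h powr (p - \<kappa>) * (real i * h) powr \<kappa> * f i"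
    using i h f_nonneg[of i] mesh_le[of i] assms by (intro mult_right_mono powr_le_mult_powr) auto
  then show "(real i * h) powr p * f i \<le> h powr (p - \<kappa>) * (f i * (real i * h) powr \<kappa>)"
    by (simp add: algebra_simps)
qed

lemma summable_moment_product:
  assumes "p \<le> \<kappa>" "q \<le> \<kappa>"
  shows "(\<lambda>(i, j). ((real i * h) powr p * f i) * ((real j * h) powr q * f j)) summable_on {1..} \<times> {1..}"
  using has_sum_product_nonneg[OF has_sum_infsum[OF summable_moment[OF assms(1)]] has_sum_infsum[OF summable_moment[OF assms(2)]]]
    f_nonneg by (auto dest: has_sum_imp_summable)

lemma summable_forward:
  assumes "\<alpha> \<ge> 0" "\<beta> \<ge> 0" "\<alpha> + \<beta> \<le> \<kappa>"
  shows "(\<lambda>(i, j). kernel \<alpha> \<beta> (real i * h) (real j * h) * f i * f j) summable_on {1..} \<times> {1..}"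
proof (rule summable_on_comparison_test)
  let ?u = "\<lambda>p q (i, j). ((real i * h) powr p * f i) * ((real j * h) powr q * f j)"
  show "(\<lambda>z. 2 powr \<beta> * (?u (\<alpha> + \<beta>) \<alpha> z + ?u \<alpha> (\<alpha> + \<beta>) z)) summable_on {1..} \<times> {1..}"
    using assms by (intro summable_on_cmult_right summable_on_add summable_moment_product) auto
  fix z :: "nat \<times> nat" assume "z \<in> {1..} \<times> {1..}"
  then obtain i j where z: "z = (i, j)" and i: "i \<ge> 1" and j: "j \<ge> 1" by auto
  have "kernel \<alpha> \<beta> (real i * h) (real j * h) * (f i * f j) \<le>
     2 powr \<beta> * ((real i * h) powr (\<alpha> + \<beta>) * (real j * h) powr \<alpha> + (real i * h) powr \<alpha> * (real j * h) powr (\<alpha> + \<beta>)) * (f i * f j)"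
    using i j f_nonneg assms by (intro mult_right_mono kernel_le_sum mesh_pos mult_nonneg_nonneg) auto
  then show "(case z of (i, j) \<Rightarrow> kernel \<alpha> \<beta> (real i * h) (real j * h) * f i * f j)
      \<le> 2 powr \<beta> * (?u (\<alpha> + \<beta>) \<alpha> z + ?u \<alpha> (\<alpha> + \<beta>) z)"
    by (simp add: z algebra_simps)
  show "0 \<le> (case z of (i, j) \<Rightarrow> kernel \<alpha> \<beta> (real i * h) (real j * h) * f i * f j)"
    using i j f_nonneg by (simp add: z kernel_nonneg)
qed

text \<open>A bounded weight makes the double series absolutely convergent, so they may be
  rearranged. The gain is reindexed by the merging pair, and the factor 2 of the loss is distributed
  over \<open>\<phi> i\<close> and \<open>\<phi> j\<close> by symmetry of the kernel.\<close>

lemma weak_S_forward: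
  assumes "\<alpha> \<ge> 0" "\<beta> \<ge> 0" "\<alpha> + \<beta> \<le> \<kappa>"
    and \<phi>: "\<And>i. i \<ge> 1 \<Longrightarrow> 0 \<le> \<phi> i \<and> \<phi> i \<le> c"
  obtains Q where "((\<lambda>i. \<phi> i * S_forward h \<alpha> \<beta> f i) has_sum Q) {1..}"
    "((\<lambda>(i, j). kernel \<alpha> \<beta> (real i * h) (real j * h) * f i * f j * (\<phi> (i + j) - \<phi> i - \<phi> j)) has_sum Q) ({1..} \<times> {1..})"
proof -
  define G where "G = (\<lambda>(i, j). kernel \<alpha> \<beta> (real i * h) (real j * h) * f i * f j)"
  have Gs: "G summable_on {1..} \<times> {1..}"
    unfolding G_def using assms by (intro summable_forward) auto
  have G_nonneg: "z \<in> {1..} \<times> {1..} \<Longrightarrow> G z \<ge> 0" for z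
    using f_nonneg by (auto simp: G_def kernel_nonneg)
  define A where "A = infsum (\<lambda>z. \<phi> (fst z + snd z) * G z) ({1..} \<times> {1..})"
  define B where "B = infsum (\<lambda>z. \<phi> (fst z) * G z) ({1..} \<times> {1..})"
  have A: "((\<lambda>z. \<phi> (fst z + snd z) * G z) has_sum A) ({1..} \<times> {1..})"
    unfolding A_def using Gs G_nonneg \<phi> by (intro has_sum_infsum summable_on_mult_bounded[where c = c]) auto
  have B: "((\<lambda>z. \<phi> (fst z) * G z) has_sum B) ({1..} \<times> {1..})"
    unfolding B_def using Gs G_nonneg \<phi> by (intro has_sum_infsum summable_on_mult_bounded[where c = c]) auto
  have B': "((\<lambda>z. \<phi> (snd z) * G z) has_sum B) ({1..} \<times> {1..})"
  proof -
    have "((\<lambda>(i, j). \<phi> j * G (j, i)) has_sum B) ({1..} \<times> {1..})"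
      using B by (subst (asm) has_sum_swap) simp
    then show ?thesis
      by (rule has_sum_cong[THEN iffD1, rotated]) (auto simp: G_def kernel_commute)
  qed
  \<comment> \<open>A merged size i with a part j < i corresponds to the pair of parts (j, i -
    j).\<close>
  have "bij_betw (\<lambda>(i, j). (j, i - j :: nat)) (Sigma {1..} (\<lambda>i. {1..<i})) ({1..} \<times> {1..})"
    by (rule bij_betwI[where g = "\<lambda>(j, l). (j + l, j)"]) auto
  from has_sum_reindex_bij_betw[OF this, of "\<lambda>z. \<phi> (fst z + snd z) * G z"]
  have "((\<lambda>(i, j). \<phi> (j + (i - j)) * G (j, i - j)) has_sum A) (Sigma {1..} (\<lambda>i. {1..<i}))"
    using A by (simp add: case_prod_unfold)
  then have "((\<lambda>i. \<Sum>j\<in>{1..<i}. \<phi> (j + (i - j)) * G (j, i - j)) has_sum A) {1..}"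
    by (rule has_sum_SigmaD) (auto intro: has_sum_finiteI)
  then have A2: "((\<lambda>i. \<phi> i * (\<Sum>j\<in>{1..<i}. kernel \<alpha> \<beta> (real j * h) (real (i - j) * h) * f j * f (i - j))) has_sum A) {1..}"
    by (rule has_sum_cong[THEN iffD1, rotated]) (auto simp: G_def sum_distrib_left intro!: sum.cong)
  have B2: "((\<lambda>i. \<phi> i * (\<Sum>\<^sub>\<infinity>j\<in>{1..}. kernel \<alpha> \<beta> (real i * h) (real j * h) * f i * f j)) has_sum B) {1..}"
  proof (rule has_sum_SigmaD[OF B])
    fix i :: nat assume i: "i \<in> {1..}"
    have "(\<lambda>j. kernel \<alpha> \<beta> (real i * h) (real j * h) * f i * f j) summable_on {1..}"
      using Gs i unfolding G_def by (rule summable_on_SigmaD1)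
    then show "((\<lambda>j. \<phi> (fst (i, j)) * G (i, j)) has_sum
        \<phi> i * (\<Sum>\<^sub>\<infinity>j\<in>{1..}. kernel \<alpha> \<beta> (real i * h) (real j * h) * f i * f j)) {1..}"
      by (simp add: G_def has_sum_cmult_right)
  qed
  show ?thesis
  proof
    show "((\<lambda>i. \<phi> i * S_forward h \<alpha> \<beta> f i) has_sum (A - 2 * B)) {1..}"
      using has_sum_diff_real[OF A2 has_sum_cmult_right[OF B2, of 2]]
      by (simp add: S_forward_def algebra_simps)
    show "((\<lambda>(i, j). kernel \<alpha> \<beta> (real i * h) (real j * h) * f i * f j * (\<phi> (i + j) - \<phi> i - \<phi> j)) has_sum (A - 2 * B)) ({1..} \<times> {1..})"
      using has_sum_diff_real[OF has_sum_diff_real[OF A B] B']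
      by (simp add: G_def case_prod_unfold algebra_simps)
  qed
qed

lemma summable_backward:
  assumes "\<alpha> \<ge> 0" "\<beta> \<ge> 0" "\<alpha> + \<beta> \<le> \<kappa>"
  shows "(\<lambda>(i, j). kernel \<alpha> \<beta> (real (j - i) * h) (real i * h) * f i * f j) summable_on (SIGMA i:{1..}. {i+1..})"
proof (rule summable_on_comparison_test)
  have "(\<lambda>(i, j). ((real i * h) powr \<alpha> * f i) * ((real j * h) powr (\<alpha> + \<beta>) * f j)) summable_on {1..} \<times> {1..}"
    using assms by (intro summable_moment_product) auto
  then show "(\<lambda>(i, j). ((real i * h) powr \<alpha> * f i) * ((real j * h) powr (\<alpha> + \<beta>) * f j)) summable_on (SIGMA i:{1..}. {i+1..})"
    by (rule summable_on_subset) auto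
  fix z :: "nat \<times> nat" assume "z \<in> (SIGMA i:{1..}. {i+1..})"
  then obtain i j where z: "z = (i, j)" and i: "i \<ge> 1" and j: "j > i" by auto
  have "kernel \<alpha> \<beta> (real j * h - real i * h) (real i * h) * (f i * f j)
      \<le> (real i * h) powr \<alpha> * (real j * h) powr (\<alpha> + \<beta>) * (f i * f j)"
    using i j f_nonneg assms h
    by (intro mult_right_mono kernel_diff_le mesh_pos mult_nonneg_nonneg) auto
  then show "(case z of (i, j) \<Rightarrow> kernel \<alpha> \<beta> (real (j - i) * h) (real i * h) * f i * f j)
      \<le> (case z of (i, j) \<Rightarrow> ((real i * h) powr \<alpha> * f i) * ((real j * h) powr (\<alpha> + \<beta>) * f j))"
    using j by (simp add: z algebra_simps)
  show "0 \<le> (case z of (i, j) \<Rightarrow> kernel \<alpha> \<beta> (real (j - i) * h) (real i * h) * f i * f j)"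
    using i j f_nonneg by (simp add: z kernel_nonneg)
qed

text \<open>All three sums are carried over to pairs i < j with one common kernel factor
  \<open>H\<close>: the finite loss sum by exchanging its indices, the last sum by replacing i with
  the complementary part j - i.\<close>

lemma weak_S_backward:
  assumes "\<alpha> \<ge> 0" "\<beta> \<ge> 0" "\<alpha> + \<beta> \<le> \<kappa>"
    and \<phi>: "\<And>i. i \<ge> 1 \<Longrightarrow> 0 \<le> \<phi> i \<and> \<phi> i \<le> c"
  obtains Q where "((\<lambda>i. \<phi> i * S_backward h \<alpha> \<beta> f i) has_sum Q) {1..}"
    "((\<lambda>(i, j). kernel \<alpha> \<beta> (real (j - i) * h) (real i * h) * f i * f j * (\<phi> i + \<phi> (j - i) - \<phi> j)) has_sum Q)
       (SIGMA i:{1..}. {i+1..})"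
proof -
  let ?P = "SIGMA i:{1::nat..}. {i+1..}"
  define H where "H = (\<lambda>(i, j). kernel \<alpha> \<beta> (real (j - i) * h) (real i * h) * f i * f j)"
  have Hs: "H summable_on ?P"
    unfolding H_def using assms by (intro summable_backward) auto
  have H_nonneg: "z \<in> ?P \<Longrightarrow> H z \<ge> 0" for z
    using f_nonneg by (auto simp: H_def kernel_nonneg)
  define A where "A = infsum (\<lambda>z. \<phi> (snd z) * H z) ?P"
  define B where "B = infsum (\<lambda>z. \<phi> (fst z) * H z) ?P"
  define C where "C = infsum (\<lambda>z. \<phi> (snd z - fst z) * H z) ?P"
  have A: "((\<lambda>z. \<phi> (snd z) * H z) has_sum A) ?P"
    unfolding A_def using Hs H_nonneg \<phi> by (intro has_sum_infsum summable_on_mult_bounded[where c = c]) auto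
  have B: "((\<lambda>z. \<phi> (fst z) * H z) has_sum B) ?P"
    unfolding B_def using Hs H_nonneg \<phi> by (intro has_sum_infsum summable_on_mult_bounded[where c = c]) auto
  have C: "((\<lambda>z. \<phi> (snd z - fst z) * H z) has_sum C) ?P"
    unfolding C_def using Hs H_nonneg \<phi> by (intro has_sum_infsum summable_on_mult_bounded[where c = c]) auto
  have "bij_betw (\<lambda>(i, j). (j, i :: nat)) (Sigma {1..} (\<lambda>i. {1..<i})) ?P"
    by (rule bij_betwI[where g = "\<lambda>(i, j). (j, i)"]) auto
  from has_sum_reindex_bij_betw[OF this, of "\<lambda>z. \<phi> (snd z) * H z"]
  have "((\<lambda>(i, j). \<phi> i * H (j, i)) has_sum A) (Sigma {1..} (\<lambda>i. {1..<i}))"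
    using A by (simp add: case_prod_unfold)
  then have "((\<lambda>i. \<Sum>j\<in>{1..<i}. \<phi> i * H (j, i)) has_sum A) {1..}"
    by (rule has_sum_SigmaD) (auto intro: has_sum_finiteI)
  then have A2: "((\<lambda>i. \<phi> i * (\<Sum>j\<in>{1..<i}. kernel \<alpha> \<beta> (real (i - j) * h) (real j * h) * f i * f j)) has_sum A) {1..}"
    by (rule has_sum_cong[THEN iffD1, rotated]) (auto simp: H_def sum_distrib_left algebra_simps intro!: sum.cong)
  have B2: "((\<lambda>i. \<phi> i * (\<Sum>\<^sub>\<infinity>j\<in>{i+1..}. kernel \<alpha> \<beta> (real (j - i) * h) (real i * h) * f i * f j)) has_sum B) {1..}"
  proof (rule has_sum_SigmaD[OF B])
    fix i :: nat assume i: "i \<in> {1..}"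
    have "(\<lambda>j. kernel \<alpha> \<beta> (real (j - i) * h) (real i * h) * f i * f j) summable_on {i+1..}"
      using Hs i unfolding H_def by (rule summable_on_SigmaD1)
    then show "((\<lambda>j. \<phi> (fst (i, j)) * H (i, j)) has_sum
        \<phi> i * (\<Sum>\<^sub>\<infinity>j\<in>{i+1..}. kernel \<alpha> \<beta> (real (j - i) * h) (real i * h) * f i * f j)) {i+1..}"
      by (simp add: H_def has_sum_cmult_right)
  qed
  \<comment> \<open>This involution exchanges the two parts of j and preserves the set of pairs i <
    j; \<open>H\<close> at the image pair is the summand of the last sum.\<close>
  have bij: "bij_betw (\<lambda>(i, j). (j - i, j)) ?P ?P"
    by (rule bij_betwI[where g = "\<lambda>(i, j). (j - i, j)"]) auto
  have C1: "((\<lambda>(i, j). \<phi> i * H (j - i, j)) has_sum C) ?P"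
  proof -
    have "((\<lambda>(i, j). \<phi> (j - (j - i)) * H (j - i, j)) has_sum C) ?P"
      using C has_sum_reindex_bij_betw[OF bij, of "\<lambda>z. \<phi> (snd z - fst z) * H z"]
      by (simp add: case_prod_unfold)
    then show ?thesis by (rule has_sum_cong[THEN iffD1, rotated]) auto
  qed
  have Hs': "(\<lambda>(i, j). H (j - i, j)) summable_on ?P"
    using Hs summable_on_reindex_bij_betw[OF bij, of H] by (simp add: case_prod_unfold)
  have C2: "((\<lambda>i. \<phi> i * (\<Sum>\<^sub>\<infinity>j\<in>{i+1..}. kernel \<alpha> \<beta> (real i * h) (real (j - i) * h) * f j * f (j - i))) has_sum C) {1..}"
  proof (rule has_sum_SigmaD[OF C1])
    fix i :: nat assume i: "i \<in> {1..}"
    have "(\<lambda>j. H (j - i, j)) summable_on {i+1..}"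
      using Hs' i by (rule summable_on_SigmaD1)
    also have "?this \<longleftrightarrow> (\<lambda>j. kernel \<alpha> \<beta> (real i * h) (real (j - i) * h) * f j * f (j - i)) summable_on {i+1..}"
      by (intro summable_on_cong) (auto simp: H_def)
    finally have "((\<lambda>j. \<phi> i * (kernel \<alpha> \<beta> (real i * h) (real (j - i) * h) * f j * f (j - i))) has_sum
        \<phi> i * (\<Sum>\<^sub>\<infinity>j\<in>{i+1..}. kernel \<alpha> \<beta> (real i * h) (real (j - i) * h) * f j * f (j - i))) {i+1..}"
      by (intro has_sum_cmult_right has_sum_infsum)
    then show "((\<lambda>j. case (i, j) of (i, j) \<Rightarrow> \<phi> i * H (j - i, j)) has_sum
        \<phi> i * (\<Sum>\<^sub>\<infinity>j\<in>{i+1..}. kernel \<alpha> \<beta> (real i * h) (real (j - i) * h) * f j * f (j - i))) {i+1..}"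
      by (rule has_sum_cong[THEN iffD1, rotated]) (auto simp: H_def)
  qed
  show ?thesis
  proof
    show "((\<lambda>i. \<phi> i * S_backward h \<alpha> \<beta> f i) has_sum (B + C - A)) {1..}"
      using has_sum_diff_real[OF has_sum_add[OF B2 C2] A2]
      by (simp add: S_backward_def algebra_simps)
    show "((\<lambda>(i, j). kernel \<alpha> \<beta> (real (j - i) * h) (real i * h) * f i * f j * (\<phi> i + \<phi> (j - i) - \<phi> j)) has_sum (B + C - A)) ?P"
      using has_sum_diff_real[OF has_sum_add[OF B C] A]
      by (simp add: H_def case_prod_unfold algebra_simps)
  qed
qed

end

section \<open>The differential inequality for bounded weights\<close>

text \<open>The family is split at a threshold s. Below it x^p \<le> s^p and the mass is 1; above it
  x^p is at most s^(p-\<delta>) x^\<delta>.\<close>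

lemma has_sum_powr_interpolation_le:
  fixes u x :: "_ \<Rightarrow> real"
  assumes mass: "(u has_sum 1) A" and D: "((\<lambda>i. x i powr \<delta> * u i) has_sum D) A" and "D > 0"
    and P: "((\<lambda>i. x i powr p * u i) has_sum P) A"
    and nonneg: "\<And>i. i \<in> A \<Longrightarrow> u i \<ge> 0 \<and> x i > 0" and p: "0 \<le> p" "p \<le> \<delta>" "\<delta> > 0"
  shows "P \<le> 2 * D powr (p / \<delta>)"
proof -
  \<comment> \<open>This threshold balances the two contributions: s^p and s^(p-\<delta>) D both
    equal D^(p/\<delta>).\<close>
  define s where "s = D powr (1 / \<delta>)"
  have s: "s > 0" using \<open>D > 0\<close> by (simp add: s_def)
  have "P \<le> s powr p * 1 + s powr (p - \<delta>) * D"
  proof (rule has_sum_mono[OF P has_sum_add[OF has_sum_cmult_right[OF mass] has_sum_cmult_right[OF D]]])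
    fix i assume i: "i \<in> A"
    have "x i powr p \<le> s powr p + s powr (p - \<delta>) * x i powr \<delta>"
    proof (cases "x i \<le> s")
      case True
      then have "x i powr p \<le> s powr p" using i nonneg p by (intro powr_mono2) (auto intro: less_imp_le)
      then show ?thesis by (simp add: add_increasing2)
    next
      case False
      then have "x i powr p \<le> s powr (p - \<delta>) * x i powr \<delta>"
        using s p by (intro powr_le_mult_powr) auto
      then show ?thesis by (simp add: add_increasing)
    qed
    then have "x i powr p * u i \<le> (s powr p + s powr (p - \<delta>) * x i powr \<delta>) * u i"
      using i nonneg by (intro mult_right_mono) auto
    then show "x i powr p * u i \<le> s powr p * u i + s powr (p - \<delta>) * (x i powr \<delta> * u i)"
      by (simp add: algebra_simps)
  qed
  also have "s powr p = D powr (p / \<delta>)" by (simp add: s_def powr_powr)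
  also have "s powr (p - \<delta>) * D = D powr ((p - \<delta>) / \<delta>) * D powr 1"
    using \<open>D > 0\<close> by (simp add: s_def powr_powr)
  also have "\<dots> = D powr (p / \<delta>)"
    using p by (simp only: powr_add[symmetric]) (simp add: diff_divide_distrib)
  finally show ?thesis by simp
qed

text \<open>Collects what the estimates use of the weight
  \<open>E_fun a (b * min (real i * h) R)\<close>. Superadditivity is asked only up to R, since a
  positive bounded weight cannot be superadditive throughout; beyond R monotonicity takes its
  place.\<close>

locale truncated_weight = moment_bounded +
  fixes \<phi> :: "nat \<Rightarrow> real" and c R :: real
  assumes weight_bounds: "\<And>i. 0 \<le> \<phi> i \<and> \<phi> i \<le> c"
    and weight_add_le: "\<And>i j. \<phi> (i + j) \<le> \<phi> i + \<phi> j + \<phi> i * \<phi> j"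
    and weight_superadditive: "\<And>i j. i < j \<Longrightarrow> real j * h \<le> R \<Longrightarrow> \<phi> i + \<phi> (j - i) \<le> \<phi> j"
    and weight_mono: "\<And>i j. i \<le> j \<Longrightarrow> \<phi> i \<le> \<phi> j"
    and cutoff_pos: "R > 0"
begin

lemma summable_weighted_moment:
  assumes "p \<le> \<kappa>"
  shows "(\<lambda>i. (real i * h) powr p * (\<phi> i * f i)) summable_on {1..}"
  using summable_on_mult_bounded[OF summable_moment[OF assms], of \<phi> c] f_nonneg weight_bounds
  by (simp add: algebra_simps)

lemma summable_weighted:
  assumes "\<kappa> \<ge> 0"
  shows "(\<lambda>i. \<phi> i * f i) summable_on {1..}"
proof -
  have "(\<lambda>i. (real i * h) powr 0 * (\<phi> i * f i)) summable_on {1..}"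
    using assms by (rule summable_weighted_moment)
  also have "?this \<longleftrightarrow> (\<lambda>i. \<phi> i * f i) summable_on {1..}"
    using h by (intro summable_on_cong) auto
  finally show ?thesis .
qed

lemma weighted_nonneg: "i \<ge> 1 \<Longrightarrow> (real i * h) powr p * (\<phi> i * f i) \<ge> 0"
  using f_nonneg weight_bounds by simp

text \<open>The product bound on \<open>\<phi> (i + j) - \<phi> i - \<phi> j\<close> attaches one
  weight to each of \<open>f i\<close> and \<open>f j\<close>, and the separated kernel bound
  factors the double sum. The two mirror-image products turn 2^\<beta> into 2^(\<beta>+1).\<close>

lemma weak_S_forward_le:
  assumes "\<alpha> \<ge> 0" "\<beta> \<ge> 0" "\<alpha> + \<beta> \<le> \<kappa>"
  obtains Q where "((\<lambda>i. \<phi> i * S_forward h \<alpha> \<beta> f i) has_sum Q) {1..}"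
    "Q \<le> 2 powr (\<beta> + 1) * (\<Sum>\<^sub>\<infinity>i\<in>{1..}. (real i * h) powr (\<alpha> + \<beta>) * (\<phi> i * f i))
       * (\<Sum>\<^sub>\<infinity>i\<in>{1..}. (real i * h) powr \<alpha> * (\<phi> i * f i))"
proof -
  let ?u = "\<lambda>p i. (real i * h) powr p * (\<phi> i * f i)"
  let ?M = "\<lambda>p. infsum (?u p) {1..}"
  obtain Q where Q: "((\<lambda>i. \<phi> i * S_forward h \<alpha> \<beta> f i) has_sum Q) {1..}"
    and Q2: "((\<lambda>(i, j). kernel \<alpha> \<beta> (real i * h) (real j * h) * f i * f j * (\<phi> (i + j) - \<phi> i - \<phi> j)) has_sum Q) ({1..} \<times> {1..})"
    by (rule weak_S_forward[of \<alpha> \<beta> \<phi> c]) (use assms weight_bounds in auto)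
  have S: "(?u p has_sum ?M p) {1..}" if "p \<le> \<kappa>" for p
    using summable_weighted_moment[OF that] by (rule has_sum_infsum)
  have SP: "((\<lambda>(i, j). ?u p i * ?u q j) has_sum (?M p * ?M q)) ({1..} \<times> {1..})" if "p \<le> \<kappa>" "q \<le> \<kappa>" for p q
    by (rule has_sum_product_nonneg[OF S S]) (use that weighted_nonneg in auto)
  have "Q \<le> 2 powr \<beta> * (?M (\<alpha> + \<beta>) * ?M \<alpha> + ?M \<alpha> * ?M (\<alpha> + \<beta>))"
  proof (rule has_sum_mono[OF Q2 has_sum_cmult_right[OF has_sum_add[OF SP SP]]])
    fix z :: "nat \<times> nat" assume "z \<in> {1..} \<times> {1..}"
    then obtain i j where z: "z = (i, j)" and i: "i \<ge> 1" and j: "j \<ge> 1" by auto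
    let ?K = "kernel \<alpha> \<beta> (real i * h) (real j * h)"
    have "?K * (f i * f j * (\<phi> (i + j) - \<phi> i - \<phi> j)) \<le> ?K * (f i * f j * (\<phi> i * \<phi> j))"
      using weight_add_le[of i j] f_nonneg[OF i] f_nonneg[OF j] by (intro mult_left_mono kernel_nonneg) auto
    also have "\<dots> \<le> 2 powr \<beta> * ((real i * h) powr (\<alpha> + \<beta>) * (real j * h) powr \<alpha>
        + (real i * h) powr \<alpha> * (real j * h) powr (\<alpha> + \<beta>)) * (f i * f j * (\<phi> i * \<phi> j))"
      using i j f_nonneg weight_bounds assms by (intro mult_right_mono kernel_le_sum mesh_pos mult_nonneg_nonneg) auto
    finally show "(case z of (i, j) \<Rightarrow> kernel \<alpha> \<beta> (real i * h) (real j * h) * f i * f j * (\<phi> (i + j) - \<phi> i - \<phi> j))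
        \<le> 2 powr \<beta> * ((case z of (i, j) \<Rightarrow> ?u (\<alpha> + \<beta>) i * ?u \<alpha> j) + (case z of (i, j) \<Rightarrow> ?u \<alpha> i * ?u (\<alpha> + \<beta>) j))"
      by (simp add: z algebra_simps)
  qed (use assms in auto)
  also have "\<dots> = 2 powr (\<beta> + 1) * ?M (\<alpha> + \<beta>) * ?M \<alpha>"
    by (simp add: powr_add)
  finally show ?thesis using Q that by blast
qed

text \<open>Pairs with j h \<le> R contribute nonpositive terms by superadditivity. For j h > R the
  power (j h)^(\<alpha>+\<beta>) is traded for R^(\<alpha>+\<beta>-\<delta>) (j h)^\<delta>, so the
  truncation error is a multiple of the absorption term, with a factor that becomes small for large
  R when \<alpha> + \<beta> < \<delta>.\<close>

lemma weak_S_backward_le: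
  assumes "\<alpha> \<ge> 0" "\<beta> \<ge> 0" "\<alpha> + \<beta> \<le> \<delta>" "\<delta> \<le> \<kappa>"
  obtains Q where "((\<lambda>i. \<phi> i * S_backward h \<alpha> \<beta> f i) has_sum Q) {1..}"
    "Q \<le> R powr (\<alpha> + \<beta> - \<delta>) * (h powr (\<alpha> - \<kappa>) * moment h \<kappa> f)
       * (\<Sum>\<^sub>\<infinity>i\<in>{1..}. (real i * h) powr \<delta> * (\<phi> i * f i))"
proof -
  let ?P = "SIGMA i:{1::nat..}. {i+1..}"
  let ?u = "\<lambda>p i. (real i * h) powr p * (\<phi> i * f i)"
  let ?v = "\<lambda>i. (real i * h) powr \<alpha> * f i"
  let ?D = "infsum (?u \<delta>) {1..}"
  obtain Q where Q: "((\<lambda>i. \<phi> i * S_backward h \<alpha> \<beta> f i) has_sum Q) {1..}"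
    and Q2: "((\<lambda>(i, j). kernel \<alpha> \<beta> (real (j - i) * h) (real i * h) * f i * f j * (\<phi> i + \<phi> (j - i) - \<phi> j)) has_sum Q) ?P"
    by (rule weak_S_backward[of \<alpha> \<beta> \<phi> c]) (use assms weight_bounds in auto)
  have S: "(?u \<delta> has_sum ?D) {1..}"
    using summable_weighted_moment assms by (intro has_sum_infsum) auto
  have V: "(?v has_sum infsum ?v {1..}) {1..}"
    using summable_moment[of \<alpha>] assms by (intro has_sum_infsum) auto
  have SP: "((\<lambda>(i, j). ?v i * ?u \<delta> j) has_sum (infsum ?v {1..} * ?D)) ({1..} \<times> {1..})"
    by (rule has_sum_product_nonneg[OF V S]) (use weighted_nonneg f_nonneg in auto)
  have "Q \<le> R powr (\<alpha> + \<beta> - \<delta>) * (infsum ?v {1..} * ?D)"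
  \<comment> \<open>The weak form runs over i < j only, the bound over all pairs; the surplus terms
    of the bound are nonnegative.\<close>
  proof (rule has_sum_mono_neutral[OF Q2 has_sum_cmult_right[OF SP]])
    fix z :: "nat \<times> nat" assume "z \<in> ?P \<inter> {1..} \<times> {1..}"
    then obtain i j where z: "z = (i, j)" and i: "i \<ge> 1" and ij: "i < j" by auto
    have j: "j \<ge> 1" using ij by simp
    let ?K = "kernel \<alpha> \<beta> (real (j - i) * h) (real i * h)"
    have K: "?K \<le> (real i * h) powr \<alpha> * (real j * h) powr (\<alpha> + \<beta>)"
      using kernel_diff_le[of "real i * h" "real j * h" \<alpha> \<beta>] i ij h assms
      by (simp add: algebra_simps)
    have "?K * (f i * f j * (\<phi> i + \<phi> (j - i) - \<phi> j)) \<le> R powr (\<alpha> + \<beta> - \<delta>) * (?v i * ?u \<delta> j)"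
    proof (cases "real j * h \<le> R")
      case True
      then have "\<phi> i + \<phi> (j - i) - \<phi> j \<le> 0" using weight_superadditive[OF ij] by simp
      then have "?K * (f i * f j * (\<phi> i + \<phi> (j - i) - \<phi> j)) \<le> 0"
        using f_nonneg[OF i] f_nonneg[OF j] by (intro mult_nonneg_nonpos kernel_nonneg) auto
      also have "0 \<le> R powr (\<alpha> + \<beta> - \<delta>) * (?v i * ?u \<delta> j)"
        using f_nonneg[OF i] weighted_nonneg[OF j] by simp
      finally show ?thesis .
    next
      case False
      have "(real j * h) powr (\<alpha> + \<beta>) \<le> R powr (\<alpha> + \<beta> - \<delta>) * (real j * h) powr \<delta>"
        using False cutoff_pos assms by (intro powr_le_mult_powr) auto
      then have "(real i * h) powr \<alpha> * (real j * h) powr (\<alpha> + \<beta>)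
          \<le> (real i * h) powr \<alpha> * (R powr (\<alpha> + \<beta> - \<delta>) * (real j * h) powr \<delta>)"
        by (intro mult_left_mono) auto
      with K have K': "?K \<le> (real i * h) powr \<alpha> * (R powr (\<alpha> + \<beta> - \<delta>) * (real j * h) powr \<delta>)"
        by linarith
      \<comment> \<open>Both parts weigh at most \<open>\<phi> j\<close>, so the bracket is at most
        2 \<open>\<phi> j\<close> - \<open>\<phi> j\<close>.\<close>
      have "\<phi> i \<le> \<phi> j" "\<phi> (j - i) \<le> \<phi> j" using ij by (auto intro: weight_mono)
      then have "?K * (f i * f j * (\<phi> i + \<phi> (j - i) - \<phi> j)) \<le> ?K * (f i * f j * \<phi> j)"
        using f_nonneg[OF i] f_nonneg[OF j] by (intro mult_left_mono kernel_nonneg) auto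
      also have "\<dots> \<le> ((real i * h) powr \<alpha> * (R powr (\<alpha> + \<beta> - \<delta>) * (real j * h) powr \<delta>)) * (f i * f j * \<phi> j)"
        using K' f_nonneg[OF i] f_nonneg[OF j] weight_bounds[of j] by (intro mult_right_mono) auto
      finally show ?thesis by (simp add: algebra_simps)
    qed
    then show "(case z of (i, j) \<Rightarrow> kernel \<alpha> \<beta> (real (j - i) * h) (real i * h) * f i * f j * (\<phi> i + \<phi> (j - i) - \<phi> j))
        \<le> R powr (\<alpha> + \<beta> - \<delta>) * (case z of (i, j) \<Rightarrow> ?v i * ?u \<delta> j)"
      by (simp add: z algebra_simps)
  qed (use weighted_nonneg f_nonneg in auto)
  also have "\<dots> \<le> R powr (\<alpha> + \<beta> - \<delta>) * ((h powr (\<alpha> - \<kappa>) * moment h \<kappa> f) * ?D)"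
    using infsum_moment_le[of \<alpha>] assms weighted_nonneg
    by (intro mult_left_mono mult_right_mono infsum_nonneg) auto
  finally show ?thesis using Q that by (simp add: mult.assoc)
qed

text \<open>A Chebyshev-type estimate. Up to \<Lambda> the weighted mass is at most e times the
  first moment, hence at most 1/4; the remaining 3/4 of the unit mass sits above \<Lambda>, where (i
  h)^\<delta> exceeds \<Lambda>^\<delta>.\<close>

lemma weighted_moment_lower_bound:
  assumes mass: "((\<lambda>i. \<phi> i * f i) has_sum 1) {1..}"
    and m1: "finite_moment h 1 f" and "\<Lambda> > 0" "\<delta> > 0" "\<delta> \<le> \<kappa>"
    and small: "\<And>i. i \<ge> 1 \<Longrightarrow> real i * h \<le> \<Lambda> \<Longrightarrow> \<phi> i \<le> e * (real i * h)"
    and e: "e \<ge> 0" "e * moment h 1 f \<le> 1/4"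
  shows "3/4 * \<Lambda> powr \<delta> \<le> (\<Sum>\<^sub>\<infinity>i\<in>{1..}. (real i * h) powr \<delta> * (\<phi> i * f i))"
proof -
  let ?D = "(\<Sum>\<^sub>\<infinity>i\<in>{1..}. (real i * h) powr \<delta> * (\<phi> i * f i))"
  have D: "((\<lambda>i. (real i * h) powr \<delta> * (\<phi> i * f i)) has_sum ?D) {1..}"
    using summable_weighted_moment assms by (intro has_sum_infsum) auto
  have M: "((\<lambda>i. f i * (real i * h) powr 1) has_sum moment h 1 f) {1..}"
    using m1 unfolding finite_moment_def moment_def by (rule has_sum_infsum)
  have "\<Lambda> powr \<delta> * 1 \<le> ?D + \<Lambda> powr \<delta> * e * moment h 1 f"
  proof (rule has_sum_mono[OF has_sum_cmult_right[OF mass] has_sum_add[OF D has_sum_cmult_right[OF M]]])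
    fix i :: nat assume "i \<in> {1..}"
    then have i: "i \<ge> 1" by simp
    note pos = f_nonneg[OF i] weight_bounds[of i] mesh_pos[OF i]
    show "\<Lambda> powr \<delta> * (\<phi> i * f i) \<le> (real i * h) powr \<delta> * (\<phi> i * f i) + \<Lambda> powr \<delta> * e * (f i * (real i * h) powr 1)"
    proof (cases "real i * h \<le> \<Lambda>")
      case True
      have "\<Lambda> powr \<delta> * (\<phi> i * f i) \<le> \<Lambda> powr \<delta> * (e * (real i * h) * f i)"
        using small[OF i True] pos by (intro mult_left_mono mult_right_mono) auto
      also have "\<dots> \<le> (real i * h) powr \<delta> * (\<phi> i * f i) + \<Lambda> powr \<delta> * (e * (real i * h) * f i)"
        using weighted_nonneg[OF i] by simp
      finally show ?thesis using pos by (simp add: algebra_simps)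
    next
      case False
      then have "\<Lambda> powr \<delta> * (\<phi> i * f i) \<le> (real i * h) powr \<delta> * (\<phi> i * f i)"
        using assms(3,4) pos by (intro mult_right_mono powr_mono2) auto
      also have "\<dots> \<le> (real i * h) powr \<delta> * (\<phi> i * f i) + \<Lambda> powr \<delta> * e * (f i * (real i * h) powr 1)"
        using pos e by simp
      finally show ?thesis .
    qed
  qed
  moreover have "\<Lambda> powr \<delta> * (e * moment h 1 f) \<le> \<Lambda> powr \<delta> * (1/4)"
    using e by (intro mult_left_mono) auto
  ultimately show ?thesis by (simp add: algebra_simps)
qed

text \<open>With D the weighted moment of order \<delta>, the budget against the absorption -D is
  D/4 for each backward operator and strictly less than D/2 for the forward one.\<close>

lemma weak_O_op_neg:
  fixes \<alpha>1 \<beta>1 \<alpha>2 \<beta>2 \<alpha>3 \<beta>3 \<delta> :: real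
  assumes pos: "\<alpha>1 > 0" "\<beta>1 > 0" "\<alpha>2 > 0" "\<beta>2 > 0" "\<alpha>3 > 0" "\<beta>3 > 0"
    and \<delta>: "\<delta> > 2 * \<alpha>1 + \<beta>1" "\<alpha>2 + \<beta>2 \<le> \<delta>" "\<alpha>3 + \<beta>3 \<le> \<delta>" "\<delta> \<le> \<kappa>"
    and mass: "((\<lambda>i. \<phi> i * f i) has_sum 1) {1..}"
    and D: "(\<Sum>\<^sub>\<infinity>i\<in>{1..}. (real i * h) powr \<delta> * (\<phi> i * f i)) > (2 powr (\<beta>1 + 4)) powr (\<delta> / (\<delta> - 2 * \<alpha>1 - \<beta>1))"
    and R: "R powr (\<alpha>2 + \<beta>2 - \<delta>) * (h powr (\<alpha>2 - \<kappa>) * moment h \<kappa> f) \<le> 1/4"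
      "R powr (\<alpha>3 + \<beta>3 - \<delta>) * (h powr (\<alpha>3 - \<kappa>) * moment h \<kappa> f) \<le> 1/4"
  obtains Z where "((\<lambda>i. \<phi> i * O_op h \<alpha>1 \<beta>1 \<alpha>2 \<beta>2 \<alpha>3 \<beta>3 \<delta> f i) has_sum Z) {1..}" "Z < 0"
proof -
  let ?u = "\<lambda>p i. (real i * h) powr p * (\<phi> i * f i)"
  define M where "M p = infsum (?u p) {1..}" for p
  let ?D = "M \<delta>"
  let ?\<theta> = "(2 * \<alpha>1 + \<beta>1) / \<delta>"
  have d: "\<delta> > 0" using pos \<delta> by linarith
  have M: "(?u p has_sum M p) {1..}" if "p \<le> \<kappa>" for p
    using summable_weighted_moment[OF that] unfolding M_def by (rule has_sum_infsum)
  have D': "?D > (2 powr (\<beta>1 + 4)) powr (\<delta> / (\<delta> - 2 * \<alpha>1 - \<beta>1))" using D by (simp add: M_def)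
  then have Dpos: "?D > 0" by (rule le_less_trans[rotated]) simp
  have interp: "0 \<le> M p \<and> M p \<le> 2 * ?D powr (p / \<delta>)" if "0 \<le> p" "p \<le> \<delta>" for p
  proof
    show "0 \<le> M p" unfolding M_def using weighted_nonneg by (intro infsum_nonneg) auto
    show "M p \<le> 2 * ?D powr (p / \<delta>)"
      by (rule has_sum_powr_interpolation_le[OF mass M _ M])
        (use that \<delta> d Dpos f_nonneg weight_bounds mesh_pos in auto)
  qed
  obtain Q1 where Q1: "((\<lambda>i. \<phi> i * S_forward h \<alpha>1 \<beta>1 f i) has_sum Q1) {1..}"
    and Q1_le: "Q1 \<le> 2 powr (\<beta>1 + 1) * M (\<alpha>1 + \<beta>1) * M \<alpha>1"
    by (rule weak_S_forward_le[of \<alpha>1 \<beta>1, folded M_def]) (use pos \<delta> in linarith)+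
  obtain Q2 where Q2: "((\<lambda>i. \<phi> i * S_backward h \<alpha>2 \<beta>2 f i) has_sum Q2) {1..}"
    and Q2_le: "Q2 \<le> R powr (\<alpha>2 + \<beta>2 - \<delta>) * (h powr (\<alpha>2 - \<kappa>) * moment h \<kappa> f) * ?D"
    by (rule weak_S_backward_le[of \<alpha>2 \<beta>2 \<delta>, folded M_def]) (use pos \<delta> in linarith)+
  obtain Q3 where Q3: "((\<lambda>i. \<phi> i * S_backward h \<alpha>3 \<beta>3 f i) has_sum Q3) {1..}"
    and Q3_le: "Q3 \<le> R powr (\<alpha>3 + \<beta>3 - \<delta>) * (h powr (\<alpha>3 - \<kappa>) * moment h \<kappa> f) * ?D"
    by (rule weak_S_backward_le[of \<alpha>3 \<beta>3 \<delta>, folded M_def]) (use pos \<delta> in linarith)+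
  have "Q2 \<le> 1/4 * ?D" using Q2_le mult_right_mono[OF R(1), of ?D] Dpos by linarith
  moreover have "Q3 \<le> 1/4 * ?D" using Q3_le mult_right_mono[OF R(2), of ?D] Dpos by linarith
  moreover have "Q1 < 1/2 * ?D"
  proof -
    have "M (\<alpha>1 + \<beta>1) * M \<alpha>1 \<le> (2 * ?D powr ((\<alpha>1 + \<beta>1) / \<delta>)) * (2 * ?D powr (\<alpha>1 / \<delta>))"
      using interp[of "\<alpha>1 + \<beta>1"] interp[of \<alpha>1] pos \<delta> by (intro mult_mono) auto
    also have "\<dots> = 4 * ?D powr ((\<alpha>1 + \<beta>1) / \<delta> + \<alpha>1 / \<delta>)"
      by (simp add: powr_add)
    also have "(\<alpha>1 + \<beta>1) / \<delta> + \<alpha>1 / \<delta> = ?\<theta>"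
      by (simp add: add_divide_distrib)
    finally have "2 powr (\<beta>1 + 1) * (M (\<alpha>1 + \<beta>1) * M \<alpha>1) \<le> 2 powr (\<beta>1 + 1) * (4 * ?D powr ?\<theta>)"
      by (intro mult_left_mono) auto
    \<comment> \<open>The constant 2^(\<beta>1+1) times 4 is written as half of 2^(\<beta>1+4),
      ready for comparison with D/2.\<close>
    also have "\<dots> = 1/2 * (2 powr (\<beta>1 + 4) * ?D powr ?\<theta>)"
      by (simp add: powr_add)
    \<comment> \<open>The assumed lower bound on D is the inequality 2^(\<beta>1+4) < D^(1-\<theta>)
      in another form, since the exponent \<delta> / (\<delta> - 2 \<alpha>1 - \<beta>1) equals
      1/(1-\<theta>).\<close>
    also have "\<dots> < 1/2 * (?D powr (1 - ?\<theta>) * ?D powr ?\<theta>)"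
    proof -
      have \<theta>: "1 - ?\<theta> = (\<delta> - 2 * \<alpha>1 - \<beta>1) / \<delta>"
        using d by (simp add: diff_divide_distrib add_divide_distrib)
      then have "1 - ?\<theta> > 0" using \<delta> d by simp
      then have "((2 powr (\<beta>1 + 4)) powr (\<delta> / (\<delta> - 2 * \<alpha>1 - \<beta>1))) powr (1 - ?\<theta>) < ?D powr (1 - ?\<theta>)"
        using D' by (intro powr_less_mono2) auto
      moreover have "\<delta> / (\<delta> - 2 * \<alpha>1 - \<beta>1) * (1 - ?\<theta>) = 1"
        unfolding \<theta> using \<delta> d by simp
      ultimately have "2 powr (\<beta>1 + 4) < ?D powr (1 - ?\<theta>)"
        by (simp only: powr_powr mult.assoc mult_1_right)
      then show ?thesis using Dpos by (intro mult_strict_left_mono mult_strict_right_mono) auto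
    qed
    also have "\<dots> = 1/2 * ?D" using Dpos by (simp only: powr_add[symmetric]) simp
    finally show ?thesis using Q1_le by (simp add: mult.assoc)
  qed
  ultimately have "Q1 + Q2 + Q3 - ?D < 0" by linarith
  moreover have "((\<lambda>i. \<phi> i * O_op h \<alpha>1 \<beta>1 \<alpha>2 \<beta>2 \<alpha>3 \<beta>3 \<delta> f i) has_sum (Q1 + Q2 + Q3 - ?D)) {1..}"
    using has_sum_diff_real[OF has_sum_add[OF has_sum_add[OF Q1 Q2] Q3] M[OF \<delta>(4)]]
    by (simp add: O_op_def V_op_def algebra_simps)
  ultimately show ?thesis using that by blast
qed

end

section \<open>Propagation in time\<close>

text \<open>If F exceeded b at t, there would be a last time s before t with F \<le> b. By the
  intermediate value theorem F equals b there, so the derivative at s is negative, although F lies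
  above b right after s.\<close>

lemma has_real_derivative_neg_barrier:
  fixes F :: "real \<Rightarrow> real"
  assumes deriv: "\<And>t. t \<ge> 0 \<Longrightarrow> (F has_real_derivative F' t) (at t within {0..})"
    and init: "F 0 \<le> b" and neg: "\<And>t. t \<ge> 0 \<Longrightarrow> F t = b \<Longrightarrow> F' t < 0"
    and t: "t \<ge> 0"
  shows "F t \<le> b"
proof (rule ccontr)
  assume "\<not> F t \<le> b"
  then have Ft: "F t > b" by simp
  define A where "A = {s \<in> {0..t}. F s \<le> b}"
  have cont: "continuous_on {0..} F"
    using deriv by (auto intro: DERIV_continuous_on)
  have A_ne: "A \<noteq> {}" using init t by (auto simp: A_def)
  have bdd: "bdd_above A" by (auto simp: A_def)
  have "closed A"
  proof -
    have "continuous_on {0..t} F" using cont by (rule continuous_on_subset) auto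
    then have "closed ({0..t} \<inter> F -` {..b})" by (intro continuous_closed_preimage) auto
    then show ?thesis by (simp add: A_def Int_def vimage_def)
  qed
  define s where "s = Sup A"
  have "s \<in> A" unfolding s_def using A_ne bdd \<open>closed A\<close> by (rule closed_contains_Sup)
  then have s: "0 \<le> s" "s < t" "F s \<le> b" using Ft by (auto simp: A_def less_le)
  have above: "F r > b" if "s < r" "r \<le> t" for r
    using that s cSup_upper[of r A] bdd by (force simp: A_def s_def)
  have "F s = b"
  proof (rule ccontr)
    assume "F s \<noteq> b"
    then obtain r where "s \<le> r" "r \<le> t" "F r = b"
      using IVT'[of F s b t] s Ft continuous_on_subset[OF cont, of "{s..t}"] by auto
    then show False using above[of r] \<open>F s \<noteq> b\<close> by (cases "r = s") auto
  qed
  from has_real_derivative_neg_dec_right[OF deriv[OF s(1)] neg[OF s(1) this]]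
  obtain d where d: "d > 0" "\<And>k. k > 0 \<Longrightarrow> s + k \<in> {0..} \<Longrightarrow> k < d \<Longrightarrow> F (s + k) < F s"
    by blast
  \<comment> \<open>The first entry keeps k inside the range of decrease, the second keeps s + k
    within the range where F is above b.\<close>
  define k where "k = min (d / 2) (t - s)"
  have "k > 0" "k < d" "s + k \<le> t" using d s by (auto simp: k_def)
  with d(2)[of k] above[of "s + k"] s show False by auto
qed

section \<open>Pairing differentiable curves in the sequence space with bounded weights\<close>

lemma ell1_iff_summable_on: "u \<in> ell1 \<longleftrightarrow> u summable_on {1..}"
  using summable_on_iff_abs_summable_on_real[of u "{1..}"] by (simp add: ell1_def)

text \<open>Pairing with a bounded weight is a bounded linear functional on \<open>ell1\<close>,
  with norm at most c; hence it commutes with derivatives taken in norm.\<close>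

lemma ell1_mult_bounded_summable:
  assumes "u \<in> ell1" "\<And>i. \<bar>\<phi> i\<bar> \<le> c"
  shows "(\<lambda>i. \<phi> i * u i) summable_on {1..}"
    and "\<bar>\<Sum>\<^sub>\<infinity>i\<in>{1..}. \<phi> i * u i\<bar> \<le> c * ell1_norm u"
proof -
  have u: "(\<lambda>i. \<bar>u i\<bar>) summable_on {1..}" using assms(1) by (simp add: ell1_def)
  have abs: "(\<lambda>i. \<bar>\<phi> i * u i\<bar>) summable_on {1..}"
    by (rule summable_on_comparison_test[OF summable_on_cmult_right[OF u, of c]])
      (use assms(2) in \<open>auto simp: abs_mult intro: mult_right_mono\<close>)
  then show sum: "(\<lambda>i. \<phi> i * u i) summable_on {1..}"
    by (rule summable_on_iff_abs_summable_on_real[THEN iffD2, unfolded real_norm_def])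
  have "\<bar>\<Sum>\<^sub>\<infinity>i\<in>{1..}. \<phi> i * u i\<bar> \<le> (\<Sum>\<^sub>\<infinity>i\<in>{1..}. \<bar>\<phi> i * u i\<bar>)"
    using norm_infsum_bound[of "\<lambda>i. \<phi> i * u i" "{1..}"] abs by simp
  also have "\<dots> \<le> (\<Sum>\<^sub>\<infinity>i\<in>{1..}. c * \<bar>u i\<bar>)"
    by (rule infsum_mono[OF abs summable_on_cmult_right[OF u]])
      (use assms(2) in \<open>auto simp: abs_mult intro: mult_right_mono\<close>)
  also have "\<dots> = c * ell1_norm u"
    by (simp add: ell1_norm_def infsum_cmult_right')
  finally show "\<bar>\<Sum>\<^sub>\<infinity>i\<in>{1..}. \<phi> i * u i\<bar> \<le> c * ell1_norm u" .
qed

lemma ell1_diff_quotient: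
  assumes "u \<in> ell1" "v \<in> ell1" "w \<in> ell1"
  shows "(\<lambda>i. (u i - v i) / r - w i) \<in> ell1"
proof -
  have "((\<lambda>i. (u i - v i) * inverse r - w i) has_sum
      ((infsum u {1..} - infsum v {1..}) * inverse r - infsum w {1..})) {1..}"
    using assms unfolding ell1_iff_summable_on
    by (intro has_sum_diff_real has_sum_cmult_left has_sum_infsum)
  then have "(\<lambda>i. (u i - v i) * inverse r - w i) summable_on {1..}"
    by (rule has_sum_imp_summable)
  then show ?thesis
    by (simp add: ell1_iff_summable_on divide_inverse)
qed

text \<open>The error of the scalar difference quotient is the pairing of \<phi> with the error of
  the vector quotient, hence at most c times a norm that tends to 0.\<close>

lemma ell1_C1_has_real_derivative:
  assumes C1: "ell1_C1 f g" and t: "t \<ge> 0" and \<phi>: "\<And>i. \<bar>\<phi> i\<bar> \<le> c"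
  shows "((\<lambda>s. \<Sum>\<^sub>\<infinity>i\<in>{1..}. \<phi> i * f s i) has_real_derivative (\<Sum>\<^sub>\<infinity>i\<in>{1..}. \<phi> i * g t i)) (at t within {0..})"
proof -
  define F where "F s = (\<Sum>\<^sub>\<infinity>i\<in>{1..}. \<phi> i * f s i)" for s
  define G where "G = (\<Sum>\<^sub>\<infinity>i\<in>{1..}. \<phi> i * g t i)"
  have f: "s \<ge> 0 \<Longrightarrow> f s \<in> ell1" for s using C1[unfolded ell1_C1_def] by blast
  have g: "g t \<in> ell1" using C1[unfolded ell1_C1_def] t by blast
  have F: "((\<lambda>i. \<phi> i * f s i) has_sum F s) {1..}" if "s \<ge> 0" for s
    unfolding F_def by (intro has_sum_infsum ell1_mult_bounded_summable(1)[OF f \<phi>] that)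
  have G: "((\<lambda>i. \<phi> i * g t i) has_sum G) {1..}"
    unfolding G_def by (intro has_sum_infsum ell1_mult_bounded_summable(1)[OF g \<phi>])
  have "((\<lambda>s. c * ell1_norm (\<lambda>i. (f s i - f t i) / (s - t) - g t i)) \<longlongrightarrow> c * 0) (at t within {0..})"
    using C1[unfolded ell1_C1_def] t by (intro tendsto_mult tendsto_const) blast
  moreover have "\<forall>\<^sub>F s in at t within {0..}. norm ((F s - F t) / (s - t) - G) \<le> c * ell1_norm (\<lambda>i. (f s i - f t i) / (s - t) - g t i)"
    unfolding eventually_at_filter
  proof (intro always_eventually allI impI)
    fix s :: real assume s: "s \<in> {0..}"
    let ?u = "\<lambda>i. (f s i - f t i) / (s - t) - g t i"
    have s': "s \<ge> 0" using s by simp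
    have eq: "\<phi> i * ?u i = (\<phi> i * f s i - \<phi> i * f t i) / (s - t) - \<phi> i * g t i" for i
      by (simp only: right_diff_distrib times_divide_eq_right)
    have "((\<lambda>i. \<phi> i * ?u i) has_sum ((F s - F t) / (s - t) - G)) {1..}"
      unfolding eq by (rule has_sum_diff_real[OF has_sum_divide_const[OF has_sum_diff_real[OF F[OF s'] F[OF t]]] G])
    then have "(F s - F t) / (s - t) - G = (\<Sum>\<^sub>\<infinity>i\<in>{1..}. \<phi> i * ?u i)"
      by (rule infsumI[symmetric])
    then show "norm ((F s - F t) / (s - t) - G) \<le> c * ell1_norm ?u"
      using ell1_mult_bounded_summable(2)[OF ell1_diff_quotient[OF f[OF s'] f[OF t] g, of "s - t"] \<phi>]
      by (simp only: real_norm_def)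
  qed
  ultimately have "((\<lambda>s. (F s - F t) / (s - t) - G) \<longlongrightarrow> 0) (at t within {0..})"
    unfolding mult_zero_right by (rule Lim_null_comparison[rotated])
  then have "((\<lambda>s. (F s - F t) / (s - t)) \<longlongrightarrow> G) (at t within {0..})"
    by (rule LIM_zero_cancel)
  then show ?thesis unfolding has_field_derivative_iff F_def G_def .
qed

text \<open>The map x \<mapsto> min x R is subadditive on nonnegative x, so the product inequality
  survives truncation. When j h \<le> R the truncation is inactive at i, j - i and j, and
  superadditivity carries over.\<close>

lemma truncated_weight_E_fun:
  assumes "moment_bounded h \<kappa> f" "a \<ge> 1" "b > 0" "R > 0"
  shows "truncated_weight h \<kappa> f (\<lambda>i. E_fun a (b * min (real i * h) R)) (E_fun a (b * R)) R"
proof -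
  interpret moment_bounded h \<kappa> f by fact
  have nn: "0 \<le> b * min (real i * h) R" for i using h assms by simp
  note mono = E_fun_mono[OF assms(2)]
  show ?thesis
  proof
    fix i j :: nat
    show "0 \<le> E_fun a (b * min (real i * h) R) \<and> E_fun a (b * min (real i * h) R) \<le> E_fun a (b * R)"
      using nn assms by (auto intro!: E_fun_nonneg mono)
    show "E_fun a (b * min (real (i + j) * h) R) \<le> E_fun a (b * min (real i * h) R)
        + E_fun a (b * min (real j * h) R) + E_fun a (b * min (real i * h) R) * E_fun a (b * min (real j * h) R)"
    proof -
      have "real i * h \<ge> 0" "real j * h \<ge> 0" using h by auto
      then have "min (real (i + j) * h) R \<le> min (real i * h) R + min (real j * h) R"
        using assms(4) by (auto simp: min_def distrib_right)
      then have "b * min (real (i + j) * h) R \<le> b * min (real i * h) R + b * min (real j * h) R"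
        using assms(3) by (simp add: distrib_left[symmetric])
      then have "E_fun a (b * min (real (i + j) * h) R) \<le> E_fun a (b * min (real i * h) R + b * min (real j * h) R)"
        by (intro mono nn)
      also have "\<dots> \<le> E_fun a (b * min (real i * h) R)
        + E_fun a (b * min (real j * h) R) + E_fun a (b * min (real i * h) R) * E_fun a (b * min (real j * h) R)"
        by (intro E_fun_add_le assms nn)
      finally show ?thesis .
    qed
    show mono': "E_fun a (b * min (real i * h) R) \<le> E_fun a (b * min (real j * h) R)" if "i \<le> j"
      using that h assms(3) by (intro mono nn mult_left_mono min.mono mult_right_mono) auto
    show "E_fun a (b * min (real i * h) R) + E_fun a (b * min (real (j - i) * h) R) \<le> E_fun a (b * min (real j * h) R)"
      if ij: "i < j" and R: "real j * h \<le> R"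
    proof -
      have eq: "b * min (real i * h) R + b * min (real (j - i) * h) R = b * (real j * h)"
      proof -
        have "real i * h \<le> real j * h" "real (j - i) * h \<le> real j * h"
          using ij h by (auto intro!: mult_right_mono)
        then have "min (real i * h) R = real i * h" "min (real (j - i) * h) R = real (j - i) * h"
          using R by auto
        then show ?thesis using ij by (simp add: algebra_simps)
      qed
      have "E_fun a (b * min (real i * h) R) + E_fun a (b * min (real (j - i) * h) R) \<le> E_fun a (b * (real j * h))"
        using E_fun_superadditive[OF assms(2) nn nn, of i "j - i"] unfolding eq .
      also have "\<dots> = E_fun a (b * min (real j * h) R)" using R by simp
      finally show ?thesis .
    qed
  qed (fact assms)
qed

text \<open>The barrier argument at level 1. Whenever the truncated mass equals 1,
  \<open>small\<close> and \<open>large\<close> force the weighted \<delta>-moment above the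
  threshold at which absorption dominates.\<close>

lemma truncated_Mittag_Leffler_moment_le_1:
  fixes f :: "real \<Rightarrow> nat \<Rightarrow> real"
  assumes pos: "\<alpha>1 > 0" "\<beta>1 > 0" "\<alpha>2 > 0" "\<beta>2 > 0" "\<alpha>3 > 0" "\<beta>3 > 0"
    and \<delta>: "\<delta> > 2 * \<alpha>1 + \<beta>1" "\<alpha>2 + \<beta>2 \<le> \<delta>" "\<alpha>3 + \<beta>3 \<le> \<delta>" "\<delta> \<le> \<kappa>"
    and C1: "ell1_C1 f (\<lambda>t. O_op h \<alpha>1 \<beta>1 \<alpha>2 \<beta>2 \<alpha>3 \<beta>3 \<delta> (f t))"
    and f: "\<And>t. t \<ge> 0 \<Longrightarrow> moment_bounded h \<kappa> (f t)"
    and m1: "\<And>t. t \<ge> 0 \<Longrightarrow> finite_moment h 1 (f t)"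
    and a: "a \<ge> 1" and b: "b > 0" and R: "R > 0"
    and small: "\<And>t. t \<ge> 0 \<Longrightarrow> b * E_fun a 1 * moment h 1 (f t) \<le> 1/4"
    and large: "3/4 * (1 / b) powr \<delta> > (2 powr (\<beta>1 + 4)) powr (\<delta> / (\<delta> - 2 * \<alpha>1 - \<beta>1))"
    and cutoff: "\<And>t. t \<ge> 0 \<Longrightarrow> R powr (\<alpha>2 + \<beta>2 - \<delta>) * (h powr (\<alpha>2 - \<kappa>) * moment h \<kappa> (f t)) \<le> 1/4"
      "\<And>t. t \<ge> 0 \<Longrightarrow> R powr (\<alpha>3 + \<beta>3 - \<delta>) * (h powr (\<alpha>3 - \<kappa>) * moment h \<kappa> (f t)) \<le> 1/4"
    and init: "(\<Sum>\<^sub>\<infinity>i\<in>{1..}. E_fun a (b * min (real i * h) R) * f 0 i) \<le> 1"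
    and t: "t \<ge> 0"
  shows "(\<Sum>\<^sub>\<infinity>i\<in>{1..}. E_fun a (b * min (real i * h) R) * f t i) \<le> 1"
proof -
  define \<phi> where "\<phi> i = E_fun a (b * min (real i * h) R)" for i
  have W: "truncated_weight h \<kappa> (f t) \<phi> (E_fun a (b * R)) R" if "t \<ge> 0" for t
    using truncated_weight_E_fun[OF f[OF that] a b R] by (simp add: \<phi>_def[abs_def])
  have bounds: "0 \<le> \<phi> i \<and> \<phi> i \<le> E_fun a (b * R)" for i
    by (rule truncated_weight.weight_bounds[OF W[OF order_refl]])
  have d: "\<delta> > 0" using pos \<delta> by linarith
  define F where "F t = (\<Sum>\<^sub>\<infinity>i\<in>{1..}. \<phi> i * f t i)" for t
  define F' where "F' t = (\<Sum>\<^sub>\<infinity>i\<in>{1..}. \<phi> i * O_op h \<alpha>1 \<beta>1 \<alpha>2 \<beta>2 \<alpha>3 \<beta>3 \<delta> (f t) i)" for t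
  have "F t \<le> 1"
  proof (rule has_real_derivative_neg_barrier[where F = F and F' = F'])
    show "(F has_real_derivative F' t) (at t within {0..})" if "t \<ge> 0" for t
      unfolding F_def[abs_def] F'_def
      by (rule ell1_C1_has_real_derivative[OF C1 that, of \<phi> "E_fun a (b * R)"]) (use bounds in auto)
    show "F 0 \<le> 1" using init by (simp add: F_def \<phi>_def)
    fix s :: real assume s: "s \<ge> 0" and Fs: "F s = 1"
    interpret truncated_weight h \<kappa> "f s" \<phi> "E_fun a (b * R)" R by (rule W[OF s])
    have mass: "((\<lambda>i. \<phi> i * f s i) has_sum 1) {1..}"
      using has_sum_infsum[OF summable_weighted] Fs d \<delta> by (simp add: F_def)
    \<comment> \<open>The bound is taken with \<Lambda> = 1/b: up to this size the argument of
      \<open>E_fun a\<close> is at most 1, so the linear bound holds with slope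
      \<open>b * E_fun a 1\<close>.\<close>
    have "3/4 * (1 / b) powr \<delta> \<le> (\<Sum>\<^sub>\<infinity>i\<in>{1..}. (real i * h) powr \<delta> * (\<phi> i * f s i))"
    proof (rule weighted_moment_lower_bound[OF mass m1[OF s], where e = "b * E_fun a 1"])
      fix i :: nat assume i: "i \<ge> 1" and le: "real i * h \<le> 1 / b"
      have "\<phi> i \<le> E_fun a (b * (real i * h))"
        unfolding \<phi>_def using R b h by (intro E_fun_mono a mult_left_mono) auto
      also have "\<dots> \<le> b * (real i * h) * E_fun a 1"
        using le b h by (intro E_fun_le_mult a) (auto simp: field_simps)
      finally show "\<phi> i \<le> b * E_fun a 1 * (real i * h)" by (simp add: algebra_simps)
    qed (use small[OF s] b d \<delta> E_fun_nonneg[OF a, of 1] in auto)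
    then obtain Z where "((\<lambda>i. \<phi> i * O_op h \<alpha>1 \<beta>1 \<alpha>2 \<beta>2 \<alpha>3 \<beta>3 \<delta> (f s) i) has_sum Z) {1..}" "Z < 0"
      using weak_O_op_neg[OF pos \<delta> mass _ cutoff(1)[OF s] cutoff(2)[OF s]] large by force
    then show "F' s < 0" by (simp add: F'_def infsumI)
  qed (rule t)
  then show ?thesis by (simp add: F_def \<phi>_def)
qed

lemma eventually_powr_cutoff:
  fixes p M :: real
  assumes "p < 0"
  shows "\<forall>\<^sub>F R in at_top. R powr p * M \<le> 1/4"
proof -
  have "((\<lambda>R. R powr p * M) \<longlongrightarrow> 0 * M) at_top"
    by (intro tendsto_mult tendsto_const tendsto_neg_powr assms filterlim_ident)
  then have "\<forall>\<^sub>F R in at_top. R powr p * M < 1/4" by (intro order_tendstoD(2)) auto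
  then show ?thesis by eventually_elim simp
qed

section \<open>Choice of the constant and removal of the cutoff\<close>

theorem theorem2p13:
  fixes \<alpha>1 \<beta>1 \<delta> :: real
  assumes "\<alpha>1 > 0" and "\<beta>1 > 0" and "\<delta> > 0" and "\<delta> > 2 * \<alpha>1 + \<beta>1"
  shows "\<exists>C>0. \<forall>h \<alpha>2 \<beta>2 \<alpha>3 \<beta>3 \<kappa> a (lam :: real). \<forall>(f0 :: nat \<Rightarrow> real) (f :: real \<Rightarrow> nat \<Rightarrow> real).
    h > 0 \<longrightarrow> \<alpha>2 > 0 \<longrightarrow> \<beta>2 > 0 \<longrightarrow> \<alpha>3 > 0 \<longrightarrow> \<beta>3 > 0 \<longrightarrow>
    \<delta> > Max {\<alpha>1 + \<beta>1, \<alpha>2 + \<beta>2, \<alpha>3 + \<beta>3} \<longrightarrow> \<delta> > 2 * \<alpha>1 + \<beta>1 - 1 \<longrightarrow>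
    \<kappa> > Max {\<delta>, 1, 2 - \<alpha>1 - \<beta>1} \<longrightarrow>
    (\<forall>i\<ge>1. f0 i \<ge> 0) \<longrightarrow> finite_moment h \<kappa> f0 \<longrightarrow>
    is_solution h \<alpha>1 \<beta>1 \<alpha>2 \<beta>2 \<alpha>3 \<beta>3 \<delta> \<kappa> f0 f \<longrightarrow>
    a \<ge> 1 \<longrightarrow> lam > 0 \<longrightarrow>
    ereal lam < min (ereal ((4 * C * sqrt a powr (\<delta> / (\<delta> - 2 * \<alpha>1 - \<beta>1))) powr (- 1 / (\<delta> * a))))
                 (if moment h 1 f0 = 0 then \<infinity>
                  else ereal ((4 * moment h 1 f0 * E_fun a 1) powr (- 1 / a))) \<longrightarrow>
    (\<lambda>i. f0 i * E_fun a (lam powr a * (real i * h))) summable_on {1..} \<longrightarrow>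
    (\<Sum>\<^sub>\<infinity>i\<in>{1..}. f0 i * E_fun a (lam powr a * (real i * h))) \<le> 1 \<longrightarrow>
    (\<forall>t\<ge>0. (\<lambda>i. f t i * E_fun a (lam powr a * (real i * h))) summable_on {1..}
       \<and> (\<Sum>\<^sub>\<infinity>i\<in>{1..}. f t i * E_fun a (lam powr a * (real i * h))) \<le> 1)"
proof -
  \<comment> \<open>C is the threshold for the weighted \<delta>-moment beyond which the absorption
    dominates.\<close>
  define C where "C = (2 powr (\<beta>1 + 4)) powr (\<delta> / (\<delta> - 2 * \<alpha>1 - \<beta>1))"
  have C: "C > 0" by (simp add: C_def)
  show ?thesis
  proof (rule exI[of _ C], intro conjI C allI impI)
    fix h \<alpha>2 \<beta>2 \<alpha>3 \<beta>3 \<kappa> a lam t :: real and f0 :: "nat \<Rightarrow> real" and f :: "real \<Rightarrow> nat \<Rightarrow> real"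
    assume h: "h > 0" and pos: "\<alpha>2 > 0" "\<beta>2 > 0" "\<alpha>3 > 0" "\<beta>3 > 0"
      and dMax: "\<delta> > Max {\<alpha>1 + \<beta>1, \<alpha>2 + \<beta>2, \<alpha>3 + \<beta>3}" and kMax: "\<kappa> > Max {\<delta>, 1, 2 - \<alpha>1 - \<beta>1}"
      and f0: "\<forall>i\<ge>1. f0 i \<ge> 0" "finite_moment h \<kappa> f0"
      and sol: "is_solution h \<alpha>1 \<beta>1 \<alpha>2 \<beta>2 \<alpha>3 \<beta>3 \<delta> \<kappa> f0 f"
      and a: "a \<ge> 1" and lam: "lam > 0"
      and lam_less: "ereal lam < min (ereal ((4 * C * sqrt a powr (\<delta> / (\<delta> - 2 * \<alpha>1 - \<beta>1))) powr (- 1 / (\<delta> * a))))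
                 (if moment h 1 f0 = 0 then \<infinity>
                  else ereal ((4 * moment h 1 f0 * E_fun a 1) powr (- 1 / a)))"
      and init_summable: "(\<lambda>i. f0 i * E_fun a (lam powr a * (real i * h))) summable_on {1..}"
      and init: "(\<Sum>\<^sub>\<infinity>i\<in>{1..}. f0 i * E_fun a (lam powr a * (real i * h))) \<le> 1"
      and t: "t \<ge> 0"
    have \<delta>: "\<alpha>2 + \<beta>2 < \<delta>" "\<alpha>3 + \<beta>3 < \<delta>" and \<kappa>: "\<delta> \<le> \<kappa>" using dMax kMax by auto
    define b where "b = lam powr a"
    have b: "b > 0" using lam by (simp add: b_def)
    have E1: "E_fun a 1 > 0" by (rule E_fun_pos[OF a]) simp
    have solution: "ell1_C1 f (\<lambda>t. O_op h \<alpha>1 \<beta>1 \<alpha>2 \<beta>2 \<alpha>3 \<beta>3 \<delta> (f t))" "\<And>i. i \<ge> 1 \<Longrightarrow> f 0 i = f0 i"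
      using sol by (auto simp: is_solution_def)
    have f: "moment_bounded h \<kappa> (f s)" if "s \<ge> 0" for s
      using sol h that by (auto simp: is_solution_def moment_bounded_def)
    have m1: "finite_moment h 1 (f s)" "moment h 1 (f s) \<le> moment h 1 f0" if "s \<ge> 0" for s
      using sol that by (auto simp: is_solution_def)
    define M where "M = max (moment h \<kappa> f0) (2 * B_bound \<alpha>1 \<beta>1 \<delta> \<kappa> (moment h 1 f0))"
    have M: "moment h \<kappa> (f s) \<le> M" if "s \<ge> 0" for s
      using sol that by (auto simp: is_solution_def M_def)
    have large: "3/4 * (1 / b) powr \<delta> > C"
    proof -
      let ?s = "sqrt a powr (\<delta> / (\<delta> - 2 * \<alpha>1 - \<beta>1))"
      have s: "?s \<ge> 1" using a assms by (intro ge_one_powr_ge_zero) auto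
      then have Cs: "C \<le> C * ?s" using C by simp
      \<comment> \<open>A negative power reverses the first bound on \<open>lam\<close> and gives
        (1/b)^\<delta> > 4 C \<open>?s\<close>. As \<open>?s\<close> is at least 1, the factor 4
        outweighs the 3/4 from the moment lower bound.\<close>
      have "((4 * C * ?s) powr (- 1 / (\<delta> * a))) powr (- (\<delta> * a)) < lam powr (- (\<delta> * a))"
        using lam_less lam a assms by (intro powr_less_mono2_neg) auto
      also have "((4 * C * ?s) powr (- 1 / (\<delta> * a))) powr (- (\<delta> * a)) = 4 * C * ?s"
        using a assms C s by (simp add: powr_powr)
      also have "lam powr (- (\<delta> * a)) = b powr (- \<delta>)"
        by (simp add: b_def powr_powr mult.commute)
      also have "\<dots> = (1 / b) powr \<delta>"
        by (simp add: powr_minus_divide powr_divide)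
      finally show ?thesis using Cs C by linarith
    qed
    have small: "b * E_fun a 1 * moment h 1 (f s) \<le> 1/4" if s: "s \<ge> 0" for s
    proof -
      have "b * E_fun a 1 * moment h 1 f0 \<le> 1/4"
      \<comment> \<open>If the first moment vanishes, the second bound on \<open>lam\<close> is
        infinite and the product on the left is 0; otherwise that bound is raised to the power
        a.\<close>
      proof (cases "moment h 1 f0 = 0")
        case False
        have "moment h 1 f0 \<ge> 0"
          unfolding moment_def using f0 by (intro infsum_nonneg) auto
        with False have m: "4 * moment h 1 f0 * E_fun a 1 > 0" using E1 by simp
        have "lam powr a \<le> ((4 * moment h 1 f0 * E_fun a 1) powr (- 1 / a)) powr a"
          using lam_less False lam a by (intro powr_mono2) auto
        also have "\<dots> = (4 * moment h 1 f0 * E_fun a 1) powr (- 1)"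
          using a by (simp add: powr_powr)
        also have "\<dots> = 1 / (4 * moment h 1 f0 * E_fun a 1)"
          using m by (simp only: powr_minus_divide powr_one less_imp_le)
        finally show ?thesis using m by (simp add: b_def field_simps)
      qed simp
      moreover have "b * E_fun a 1 * moment h 1 (f s) \<le> b * E_fun a 1 * moment h 1 f0"
        using m1[OF s] b E1 by (intro mult_left_mono) auto
      ultimately show ?thesis by linarith
    qed
    have nonneg: "f t i * E_fun a (b * (real i * h)) \<ge> 0" if "i \<in> {1..}" for i
      using sol t that b h by (auto simp: is_solution_def intro!: mult_nonneg_nonneg E_fun_nonneg[OF a])
    have finite_sum: "(\<Sum>i\<in>I. f t i * E_fun a (b * (real i * h))) \<le> 1" if I: "finite I" "I \<subseteq> {1..}" for I
    proof -
      \<comment> \<open>R is chosen after the finite set I: beyond all its mesh points, so that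
        truncation is invisible on I, and so large that both backward errors are small. Since
        \<open>M\<close> bounds the \<kappa>-moment at all times, one R serves the whole
        evolution.\<close>
      have "\<forall>\<^sub>F R in at_top. R > 0 \<and> (\<forall>i\<in>I. real i * h \<le> R)
          \<and> R powr (\<alpha>2 + \<beta>2 - \<delta>) * (h powr (\<alpha>2 - \<kappa>) * M) \<le> 1/4
          \<and> R powr (\<alpha>3 + \<beta>3 - \<delta>) * (h powr (\<alpha>3 - \<kappa>) * M) \<le> 1/4"
        using I \<delta> by (intro eventually_conj eventually_gt_at_top eventually_ball_finite ballI
            eventually_ge_at_top eventually_powr_cutoff) auto
      then obtain R where R: "R > 0" "\<And>i. i \<in> I \<Longrightarrow> real i * h \<le> R"
          "R powr (\<alpha>2 + \<beta>2 - \<delta>) * (h powr (\<alpha>2 - \<kappa>) * M) \<le> 1/4"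
          "R powr (\<alpha>3 + \<beta>3 - \<delta>) * (h powr (\<alpha>3 - \<kappa>) * M) \<le> 1/4"
        by (metis (mono_tags, lifting) eventually_happens' trivial_limit_at_top_linorder)
      let ?\<phi> = "\<lambda>i. E_fun a (b * min (real i * h) R)"
      have W: "truncated_weight h \<kappa> (f s) ?\<phi> (E_fun a (b * R)) R" if "s \<ge> 0" for s
        using truncated_weight_E_fun[OF f[OF that] a b R(1)] .
      have sum: "(\<lambda>i. ?\<phi> i * f s i) summable_on {1..}" if "s \<ge> 0" for s
        using truncated_weight.summable_weighted[OF W[OF that]] \<kappa> assms by simp
      have "(\<Sum>i\<in>I. f t i * E_fun a (b * (real i * h))) = (\<Sum>i\<in>I. ?\<phi> i * f t i)"
        using R(2) by (intro sum.cong) (auto simp: min_def)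
      also have "\<dots> \<le> (\<Sum>\<^sub>\<infinity>i\<in>{1..}. ?\<phi> i * f t i)"
        using I sum[OF t] truncated_weight.weight_bounds[OF W[OF t]] sol t
        by (intro finite_sum_le_infsum) (auto simp: is_solution_def)
      also have "\<dots> \<le> 1"
      proof (rule truncated_Mittag_Leffler_moment_le_1[OF assms(1,2) pos assms(4) less_imp_le[OF \<delta>(1)]
            less_imp_le[OF \<delta>(2)] \<kappa> solution(1) f m1(1) a b R(1) small large[unfolded C_def] _ _ _ t])
        fix s :: real assume s: "s \<ge> 0"
        have "R powr p * (h powr q * moment h \<kappa> (f s)) \<le> R powr p * (h powr q * M)" for p q
          using M[OF s] by (intro mult_left_mono) auto
        then show "R powr (\<alpha>2 + \<beta>2 - \<delta>) * (h powr (\<alpha>2 - \<kappa>) * moment h \<kappa> (f s)) \<le> 1/4"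
          "R powr (\<alpha>3 + \<beta>3 - \<delta>) * (h powr (\<alpha>3 - \<kappa>) * moment h \<kappa> (f s)) \<le> 1/4"
          using R(3,4) order_trans by blast+
      next
        \<comment> \<open>The truncated weight lies below the full one, so the truncated problem
          inherits the initial bound.\<close>
        have "(\<Sum>\<^sub>\<infinity>i\<in>{1..}. ?\<phi> i * f 0 i) \<le> (\<Sum>\<^sub>\<infinity>i\<in>{1..}. f0 i * E_fun a (b * (real i * h)))"
        proof (rule infsum_mono[OF sum[OF order_refl] init_summable[folded b_def]])
          fix i :: nat assume i: "i \<in> {1..}"
          have "?\<phi> i \<le> E_fun a (b * (real i * h))"
            using R(1) b h by (intro E_fun_mono a mult_left_mono) auto
          then show "?\<phi> i * f 0 i \<le> f0 i * E_fun a (b * (real i * h))"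
            using i solution(2)[of i] f0(1) by (simp add: mult.commute mult_left_mono)
        qed
        also have "\<dots> \<le> 1" using init by (simp add: b_def)
        finally show "(\<Sum>\<^sub>\<infinity>i\<in>{1..}. ?\<phi> i * f 0 i) \<le> 1" .
      qed auto
      finally show ?thesis .
    qed
    \<comment> \<open>Nonnegative terms with finite partial sums bounded by 1: convergence of the
      full weighted sum at time t is obtained here, as a conclusion.\<close>
    have sum: "(\<lambda>i. f t i * E_fun a (b * (real i * h))) summable_on {1..}"
      by (rule nonneg_bdd_above_summable_on[OF nonneg]) (use finite_sum in \<open>auto intro!: bdd_aboveI2\<close>)
    then show "(\<lambda>i. f t i * E_fun a (lam powr a * (real i * h))) summable_on {1..}"
      by (simp add: b_def)
    show "(\<Sum>\<^sub>\<infinity>i\<in>{1..}. f t i * E_fun a (lam powr a * (real i * h))) \<le> 1"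
      using infsum_le_finite_sums[OF sum finite_sum] by (simp add: b_def)
  qed
qed

end
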